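(* Let $\mathcal{H}$ be a nontrivial complex Hilbert space, let $A\in\mathcal{B}(\mathcal{H})$ be positive and nonzero, and let $T\in\mathcal{B}_A(\mathcal{H})$. Then the following statements are equivalent: (1) $T\parallel_A I$, where $I$ is the identity operator on $\mathcal{H}$. (2) $T\parallel_A T^{\sharp_A}$. (3) $T^{\sharp_A}T\parallel_A T^{\sharp_A}$.
   Context: $\mathcal{B}(\mathcal{H})$ denotes the bounded linear operators on $\mathcal{H}$. Positive means $\langle Ax,x\rangle\ge 0$ for all $x$. Put $\langle x,y\rangle_A=\langle Ax,y\rangle$ and $\|x\|_A=\sqrt{\langle x,x\rangle_A}$. $\mathcal{B}_{A^{1/2}}(\mathcal{H})$ is the set of $A$-bounded operators, i.e. those $T\in\mathcal{B}(\mathcal{H})$ for which there is $c>0$ with $\|Tx\|_A\le c\|x\|_A$ for all $x\in\mathcal{H}$; for such $T$, $\|T\|_A=\sup\{\|Tx\|_A : x\in\mathcal{H},\ \|x\|_A=1\}$. $\mathcal{B}_A(\mathcal{H})=\{T\in\mathcal{B}(\mathcal{H}) : \mathcal{R}(T^*A)\subseteq\mathcal{R}(A)\}$ ($\mathcal{R}$ denotes range); one has $\mathcal{B}_A(\mathcal{H})\subseteq\mathcal{B}_{A^{1/2}}(\mathcal{H})$. For $T\in\mathcal{B}_A(\mathcal{H})$, $T^{\sharp_A}$ is the unique $X\in\mathcal{B}(\mathcal{H})$ with $AX=T^*A$ and $\mathcal{R}(X)\subseteq\overline{\mathcal{R}(A)}$. For $T,S\in\mathcal{B}_{A^{1/2}}(\mathcal{H})$,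 $T\parallel_A S$ ($A$-norm-parallel) means that there is $\lambda\in\mathbb{C}$ with $|\lambda|=1$ and $\|T+\lambda S\|_A=\|T\|_A+\|S\|_A$. *)

theory Defs
  imports "HOL-Analysis.Analysis"
begin

text \<open>The inner product is linear in its first argument. Since \<^term>\<open>norm x = 0\<close> only for
  \<^term>\<open>x = 0\<close>, the axiom \<open>cinner_self\<close> contains positive definiteness as well as the fact that
  the norm is the one induced by the inner product.\<close>

class complex_inner = real_normed_vector +
  fixes scaleC :: "complex \<Rightarrow> 'a \<Rightarrow> 'a"  (infixr "*\<^sub>C" 75)
    and cinner :: "'a \<Rightarrow> 'a \<Rightarrow> complex"
  assumes scaleC_add_right: "c *\<^sub>C (x + y) = c *\<^sub>C x + c *\<^sub>C y"
    and scaleC_add_left: "(c + d) *\<^sub>C x = c *\<^sub>C x + d *\<^sub>C x"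
    and scaleC_scaleC: "c *\<^sub>C d *\<^sub>C x = (c * d) *\<^sub>C x"
    and scaleR_scaleC: "r *\<^sub>R x = complex_of_real r *\<^sub>C x"
    and cinner_commute: "cinner x y = cnj (cinner y x)"
    and cinner_add_left: "cinner (x + y) z = cinner x z + cinner y z"
    and cinner_scaleC_left: "cinner (c *\<^sub>C x) y = c * cinner x y"
    and cinner_self: "cinner x x = complex_of_real ((norm x)\<^sup>2)"

class chilbert_space = complex_inner + complete_space

instantiation complex :: chilbert_space
begin

definition scaleC_complex :: "complex \<Rightarrow> complex \<Rightarrow> complex"
  where "scaleC_complex c x = c * x"

definition cinner_complex :: "complex \<Rightarrow> complex \<Rightarrow> complex"
  where "cinner_complex x y = x * cnj y"

instance
  by standard
    (simp_all add: scaleC_complex_def cinner_complex_def algebra_simps scaleR_conv_of_real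
      complex_norm_square[symmetric] del: of_real_power)

end

definition bounded_clinear :: "('a::complex_inner \<Rightarrow> 'b::complex_inner) \<Rightarrow> bool"
  where "bounded_clinear T \<longleftrightarrow> bounded_linear T \<and> (\<forall>c x. T (c *\<^sub>C x) = c *\<^sub>C T x)"

text \<open>By the Riesz representation theorem, the description is proper for bounded operators on a
  Hilbert space.\<close>

definition cadjoint :: "('a::chilbert_space \<Rightarrow> 'a) \<Rightarrow> 'a \<Rightarrow> 'a"
  where "cadjoint T = (THE S. bounded_clinear S \<and> (\<forall>x y. cinner (T x) y = cinner x (S y)))"

text \<open>Membership in \<open>\<real>\<^sub>\<ge>\<^sub>0\<close> says that the complex number \<^term>\<open>cinner (A x) x\<close> is real and
  nonnegative.\<close>

definition positive_op :: "('a::chilbert_space \<Rightarrow> 'a) \<Rightarrow> bool"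
  where "positive_op A \<longleftrightarrow> bounded_clinear A \<and> (\<forall>x. cinner (A x) x \<in> \<real>\<^sub>\<ge>\<^sub>0)"

definition A_inner :: "('a::chilbert_space \<Rightarrow> 'a) \<Rightarrow> 'a \<Rightarrow> 'a \<Rightarrow> complex"
  where "A_inner A x y = cinner (A x) y"

definition A_seminorm :: "('a::chilbert_space \<Rightarrow> 'a) \<Rightarrow> 'a \<Rightarrow> real"
  where "A_seminorm A x = sqrt (Re (A_inner A x x))"

definition A_bounded_ops :: "('a::chilbert_space \<Rightarrow> 'a) \<Rightarrow> ('a \<Rightarrow> 'a) set"
  where "A_bounded_ops A =
    {T. bounded_clinear T \<and> (\<exists>c>0. \<forall>x. A_seminorm A (T x) \<le> c * A_seminorm A x)}"

text \<open>The supremum is over a nonempty bounded set of reals when \<open>A \<noteq> 0\<close> is positive and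
  \<open>T\<close> is in \<^term>\<open>A_bounded_ops A\<close>.\<close>

definition A_opnorm :: "('a::chilbert_space \<Rightarrow> 'a) \<Rightarrow> ('a \<Rightarrow> 'a) \<Rightarrow> real"
  where "A_opnorm A T = Sup {A_seminorm A (T x) | x. A_seminorm A x = 1}"

definition A_adjointable_ops :: "('a::chilbert_space \<Rightarrow> 'a) \<Rightarrow> ('a \<Rightarrow> 'a) set"
  where "A_adjointable_ops A = {T. bounded_clinear T \<and> range (cadjoint T \<circ> A) \<subseteq> range A}"

text \<open>By Douglas' range inclusion theorem, the description is proper for \<open>T\<close> in
  \<^term>\<open>A_adjointable_ops A\<close>.\<close>

definition A_adjoint :: "('a::chilbert_space \<Rightarrow> 'a) \<Rightarrow> ('a \<Rightarrow> 'a) \<Rightarrow> 'a \<Rightarrow> 'a"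
  where "A_adjoint A T =
    (THE X. bounded_clinear X \<and> A \<circ> X = cadjoint T \<circ> A \<and> range X \<subseteq> closure (range A))"

text \<open>The relation is only meant for \<open>A\<close>-bounded operators, so it is false for others.\<close>

definition A_parallel :: "('a::chilbert_space \<Rightarrow> 'a) \<Rightarrow> ('a \<Rightarrow> 'a) \<Rightarrow> ('a \<Rightarrow> 'a) \<Rightarrow> bool"
  where "A_parallel A T S \<longleftrightarrow> T \<in> A_bounded_ops A \<and> S \<in> A_bounded_ops A \<and>
    (\<exists>c::complex. cmod c = 1 \<and>
      A_opnorm A (\<lambda>x. T x + c *\<^sub>C S x) = A_opnorm A T + A_opnorm A S)"

end

theory Submission
  imports Defs
begin

text \<open>Let \<open>t\<close> be the \<open>A\<close>-norm of \<open>T\<close> and \<open>X\<close> its \<open>A\<close>-adjoint. All three statements are equivalent to \<open>T\<close> having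
  an approximate eigenvalue \<open>t c\<close> with \<open>|c| = 1\<close>, with respect to the \<open>A\<close>-seminorm. Equality in the
  triangle inequality forces near-extremal vectors to satisfy \<open>\<parallel>S\<parallel> T x \<approx> c \<parallel>T\<parallel> S x\<close>. For \<open>S = I\<close> this
  is the claim. For \<open>S = X\<close> it gives \<open>T\<^sup>2 x \<approx> c t\<^sup>2 x\<close>, and one factors \<open>T\<^sup>2 - c t\<^sup>2\<close>. For the pair \<open>X T\<close>, \<open>X\<close>
  it is combined with \<open>X T x \<approx> t\<^sup>2 x\<close>, valid whenever \<open>x\<close> almost attains the norm of \<open>T\<close>.
  The description of the \<open>A\<close>-adjoint is proper because \<open>A\<close> is injective on the closure of its range;
  boundedness is a Baire category argument, and \<open>A\<close>-boundedness follows by iterating Cauchy--Schwarz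
  for the \<open>A\<close>-selfadjoint operator \<open>X T\<close>.\<close>

subsection \<open>The semi-inner product of a positive operator\<close>

lemma scaleC_one [simp]: "1 *\<^sub>C x = (x::'a::complex_inner)"
  using scaleR_scaleC [of 1 x] by simp

lemma scaleC_zero_left [simp]: "0 *\<^sub>C x = (0::'a::complex_inner)"
  using scaleR_scaleC [of 0 x] by simp

lemma scaleC_minus_one: "(-1) *\<^sub>C x = - (x::'a::complex_inner)"
  using scaleR_scaleC [of "-1" x] by simp

lemma cinner_zero_left [simp]: "cinner 0 y = 0"
  using cinner_scaleC_left [of 0 0 y] by simp

lemma cinner_zero_right [simp]: "cinner x 0 = 0"
  using cinner_commute [of x 0] by simp

lemma cinner_add_right: "cinner x (y + z) = cinner x y + cinner x z"
  by (metis cinner_add_left cinner_commute complex_cnj_add)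

lemma cinner_scaleC_right: "cinner x (c *\<^sub>C y) = cnj c * cinner x y"
  by (metis cinner_commute cinner_scaleC_left complex_cnj_mult)

lemma cinner_minus_left: "cinner (- x) y = - cinner x y"
  using cinner_scaleC_left [of "-1" x y] by (simp add: scaleC_minus_one)

lemma cinner_diff_left: "cinner (x - y) z = cinner x z - cinner y z"
  using cinner_add_left [of x "- y" z] by (simp add: cinner_minus_left)

lemma cinner_minus_right: "cinner x (- y) = - cinner x y"
  using cinner_scaleC_right [of x "-1" y] by (simp add: scaleC_minus_one)

lemma cinner_diff_right: "cinner x (y - z) = cinner x y - cinner x z"
  using cinner_add_right [of x y "- z"] by (simp add: cinner_minus_right)

lemma cinner_ext_right: "(\<And>x. cinner x u = cinner x v) \<Longrightarrow> u = v"
proof -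
  assume "\<And>x. cinner x u = cinner x v"
  then have "cinner (u - v) (u - v) = 0" by (simp add: cinner_diff_right)
  then show "u = v" by (simp add: cinner_self)
qed

section \<open>Bounded complex-linear maps\<close>

lemma bounded_clinear_linear: "bounded_clinear T \<Longrightarrow> bounded_linear T"
  and bounded_clinear_add: "bounded_clinear T \<Longrightarrow> T (x + y) = T x + T y"
  and bounded_clinear_diff: "bounded_clinear T \<Longrightarrow> T (x - y) = T x - T y"
  and bounded_clinear_zero: "bounded_clinear T \<Longrightarrow> T 0 = 0"
  and bounded_clinear_scaleC: "bounded_clinear T \<Longrightarrow> T (c *\<^sub>C x) = c *\<^sub>C T x"
  unfolding bounded_clinear_def
  by (auto simp: linear_simps)

lemma bounded_clinear_id: "bounded_clinear id"
  by (simp add: bounded_clinear_def bounded_linear_ident id_def)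

lemma bounded_clinear_comp:
  "bounded_clinear S \<Longrightarrow> bounded_clinear T \<Longrightarrow> bounded_clinear (S \<circ> T)"
  by (simp add: bounded_clinear_def comp_def bounded_linear_compose)

lemma bounded_clinearI:
  fixes T :: "'a::complex_inner \<Rightarrow> 'b::complex_inner"
  assumes add: "\<And>x y. T (x + y) = T x + T y" and scale: "\<And>c x. T (c *\<^sub>C x) = c *\<^sub>C T x"
    and bd: "\<And>x. norm (T x) \<le> norm x * K"
  shows "bounded_clinear T"
  unfolding bounded_clinear_def
proof (intro conjI allI)
  show "bounded_linear T"
    by (rule bounded_linear_intro[where K = K]) (simp_all add: add scale bd scaleR_scaleC)
qed (rule scale)

lemma bounded_clinear_bound:
  assumes "bounded_clinear T"
  obtains K where "K > 0" "\<And>x. norm (T x) \<le> K * norm x"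
  using bounded_linear.pos_bounded[OF bounded_clinear_linear[OF assms]] by (auto simp: mult.commute)

text \<open>Instantiating \<open>A = id\<close> turns \<open>A_inner A\<close> into
  \<open>cinner\<close> and the seminorm into the norm, so the Hilbert space versions of
  polarization and Cauchy--Schwarz come as special cases.\<close>

locale positive_operator =
  fixes A :: "'a::chilbert_space \<Rightarrow> 'a"
  assumes positive: "positive_op A"
begin

abbreviation ip where "ip \<equiv> A_inner A"
abbreviation N where "N \<equiv> A_seminorm A"

lemma bcl: "bounded_clinear A"
  using positive by (simp add: positive_op_def)

lemma ip_add_left: "ip (x + y) z = ip x z + ip y z"
  by (simp add: A_inner_def bounded_clinear_add[OF bcl] cinner_add_left)

lemma ip_diff_left: "ip (x - y) z = ip x z - ip y z"
  by (simp add: A_inner_def bounded_clinear_diff[OF bcl] cinner_diff_left)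

lemma ip_scaleC_left: "ip (c *\<^sub>C x) z = c * ip x z"
  by (simp add: A_inner_def bounded_clinear_scaleC[OF bcl] cinner_scaleC_left)

lemma ip_add_right: "ip z (x + y) = ip z x + ip z y"
  by (simp add: A_inner_def cinner_add_right)

lemma ip_diff_right: "ip z (x - y) = ip z x - ip z y"
  by (simp add: A_inner_def cinner_diff_right)

lemma ip_scaleC_right: "ip z (c *\<^sub>C x) = cnj c * ip z x"
  by (simp add: A_inner_def cinner_scaleC_right)

lemmas ip_simps = ip_add_left ip_diff_left ip_scaleC_left ip_add_right ip_diff_right ip_scaleC_right

lemma Re_ip_self: "Re (ip x x) \<ge> 0" and Im_ip_self: "Im (ip x x) = 0"
  using positive by (auto simp: positive_op_def A_inner_def complex_nonneg_Reals_iff)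

text \<open>Hermitian symmetry is polarization: the diagonal is real at \<open>x + y\<close> and at \<open>x + i y\<close>.\<close>

lemma ip_commute: "ip x y = cnj (ip y x)"
proof (rule complex_eqI)
  show "Im (ip x y) = Im (cnj (ip y x))"
    using Im_ip_self[of "x + y"] by (simp add: ip_simps Im_ip_self)
  show "Re (ip x y) = Re (cnj (ip y x))"
    using Im_ip_self[of "x + \<i> *\<^sub>C y"] by (simp add: ip_simps Im_ip_self)
qed

lemma selfadjoint: "cinner (A x) y = cinner x (A y)"
  using ip_commute[of x y] cinner_commute[of x "A y"] by (simp add: A_inner_def)

lemma N_nonneg [simp]: "N x \<ge> 0"
  by (simp add: A_seminorm_def Re_ip_self)

lemma N_sq: "(N x)\<^sup>2 = Re (ip x x)"
  by (simp add: A_seminorm_def Re_ip_self)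

lemma ip_self: "ip x x = complex_of_real ((N x)\<^sup>2)"
  by (simp add: complex_eq_iff N_sq Im_ip_self)

lemma N_sq_add: "(N (x + y))\<^sup>2 = (N x)\<^sup>2 + (N y)\<^sup>2 + 2 * Re (ip x y)"
  using ip_commute[of y x] by (simp add: N_sq ip_simps)

lemma N_sq_diff: "(N (x - y))\<^sup>2 = (N x)\<^sup>2 + (N y)\<^sup>2 - 2 * Re (ip x y)"
  using ip_commute[of y x] by (simp add: N_sq ip_simps)

lemma N_scaleC: "N (c *\<^sub>C x) = cmod c * N x"
proof -
  have "ip (c *\<^sub>C x) (c *\<^sub>C x) = (c * cnj c) * ip x x"
    by (simp add: ip_simps)
  also have "\<dots> = of_real ((cmod c)\<^sup>2 * (N x)\<^sup>2)"
    by (simp only: complex_norm_square[symmetric] ip_self of_real_mult)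
  finally have "(N (c *\<^sub>C x))\<^sup>2 = (cmod c * N x)\<^sup>2"
    by (simp only: N_sq[of "c *\<^sub>C x"] Re_complex_of_real power_mult_distrib)
  then show ?thesis by simp
qed

lemma N_zero [simp]: "N 0 = 0"
  using N_scaleC[of 0 0] by simp

lemma cauchy_schwarz: "cmod (ip x y) \<le> N x * N y"
proof -
  define b where "b = cmod (ip x y)"
  \<comment> \<open>This expands the squared seminorm of \<open>x - (s * ip x y) y\<close>, which is
    nonnegative for every real \<open>s\<close>.\<close>
  have quad: "0 \<le> (N x)\<^sup>2 + s\<^sup>2 * b\<^sup>2 * (N y)\<^sup>2 - 2 * s * b\<^sup>2" for s :: real
  proof -
    have "Re (cnj (of_real s * ip x y) * ip x y) = s * b\<^sup>2"
      unfolding b_def cmod_power2 by (simp add: power2_eq_square algebra_simps)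
    moreover have "0 \<le> (N (x - (of_real s * ip x y) *\<^sub>C y))\<^sup>2" by simp
    ultimately show ?thesis
      unfolding N_sq_diff N_scaleC ip_simps b_def norm_mult power_mult_distrib by simp
  qed
  have "b\<^sup>2 \<le> (N x)\<^sup>2 * (N y)\<^sup>2"
  proof (cases "N y = 0")
    case True
    have "b = 0"
    proof (rule ccontr)
      assume "b \<noteq> 0"
      \<comment> \<open>With \<open>N y = 0\<close> only
        \<open>(N x)\<^sup>2 - 2 * s * b\<^sup>2\<close> remains; this \<open>s\<close> makes it
        equal to -1.\<close>
      then show False using quad[of "((N x)\<^sup>2 + 1) / (2 * b\<^sup>2)"] True by simp
    qed
    then show ?thesis by simp
  next
    case False
    have scale: "(1 / d)\<^sup>2 * c * d - 2 * (1 / d) * c = - (c / d)" if "d \<noteq> 0" for c d :: real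
      using that by (simp add: power2_eq_square)
    have "(N y)\<^sup>2 > 0" using False by simp
    \<comment> \<open>The quadratic is minimal at \<open>s = 1 / (N y)\<^sup>2\<close>.\<close>
    then have "b\<^sup>2 / (N y)\<^sup>2 \<le> (N x)\<^sup>2"
      using quad[of "1 / (N y)\<^sup>2"] scale[of "(N y)\<^sup>2" "b\<^sup>2"] by linarith
    then show ?thesis using \<open>(N y)\<^sup>2 > 0\<close> by (simp only: pos_divide_le_eq)
  qed
  then have "b\<^sup>2 \<le> (N x * N y)\<^sup>2"
    by (simp add: power_mult_distrib)
  then have "b \<le> N x * N y"
    by (rule power2_le_imp_le) simp
  then show ?thesis by (simp add: b_def)
qed

lemma N_triangle: "N (x + y) \<le> N x + N y"
proof (rule power2_le_imp_le)
  show "(N (x + y))\<^sup>2 \<le> (N x + N y)\<^sup>2"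
    using cauchy_schwarz[of x y] complex_Re_le_cmod[of "ip x y"]
    by (simp add: N_sq_add power2_sum)
qed simp

lemma N_minus_commute: "N (x - y) = N (y - x)"
  using N_scaleC[of "-1" "x - y"] by (simp add: scaleC_minus_one)

lemma N_triangle_diff: "N (x - z) \<le> N (x - y) + N (y - z)"
  using N_triangle[of "x - y" "y - z"] by simp

lemma N_triangle_sub: "\<bar>N x - N y\<bar> \<le> N (x - y)"
  using N_triangle[of "x - y" y] N_triangle[of "y - x" x] N_minus_commute[of x y] by simp

end

subsection \<open>Orthogonal projection, Riesz representation and adjoints\<close>

lemma positive_operator_id: "positive_operator (id :: 'a::chilbert_space \<Rightarrow> 'a)"
  by (simp add: positive_operator_def positive_op_def bounded_clinear_id cinner_self)

lemma A_seminorm_id [simp]: "A_seminorm id x = norm (x::'a::chilbert_space)"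
  by (simp add: A_seminorm_def A_inner_def cinner_self)

lemma norm_cinner_le: "cmod (cinner x y) \<le> norm x * norm (y::'a::chilbert_space)"
  using positive_operator.cauchy_schwarz[OF positive_operator_id, of x y]
  by (simp add: A_inner_def)

lemma norm_sq_add: "(norm (x + y))\<^sup>2 = (norm x)\<^sup>2 + (norm y)\<^sup>2 + 2 * Re (cinner x (y::'a::chilbert_space))"
  using positive_operator.N_sq_add[OF positive_operator_id, of x y] by (simp add: A_inner_def)

lemma norm_sq_diff: "(norm (x - y))\<^sup>2 = (norm x)\<^sup>2 + (norm y)\<^sup>2 - 2 * Re (cinner x (y::'a::chilbert_space))"
  using positive_operator.N_sq_diff[OF positive_operator_id, of x y] by (simp add: A_inner_def)

lemma norm_scaleC: "norm (c *\<^sub>C (x::'a::chilbert_space)) = cmod c * norm x"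
  using positive_operator.N_scaleC[OF positive_operator_id, of c x] by simp

lemma continuous_on_cinner_left: "continuous_on S (\<lambda>x. cinner x (y::'a::chilbert_space))"
proof -
  have "bounded_linear (\<lambda>x. cinner x y)"
    by (rule bounded_linear_intro[where K = "norm y"])
      (simp_all add: cinner_add_left scaleR_scaleC cinner_scaleC_left scaleC_complex_def norm_cinner_le)
  then show ?thesis
    by (rule linear_continuous_on)
qed

text \<open>By the parallelogram law a minimizing sequence is Cauchy, because midpoints stay in
  \<open>M\<close> and hence at distance at least \<open>d\<close> from \<open>y\<close>.
  Completeness gives the limit and closedness puts it into \<open>M\<close>.\<close>

lemma nearest_point_exists:
  fixes M :: "'a::chilbert_space set"
  assumes "closed M" "M \<noteq> {}" and mid: "\<And>x y. x \<in> M \<Longrightarrow> y \<in> M \<Longrightarrow> (1/2) *\<^sub>R (x + y) \<in> M"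
  obtains p where "p \<in> M" "\<And>m. m \<in> M \<Longrightarrow> norm (y - p) \<le> norm (y - m)"
proof -
  define d where "d = Inf ((\<lambda>m. norm (y - m)) ` M)"
  have bdd: "bdd_below ((\<lambda>m. norm (y - m)) ` M)"
    by (rule bdd_belowI[of _ 0]) auto
  have d_le: "d \<le> norm (y - m)" if "m \<in> M" for m
    unfolding d_def using that by (intro cInf_lower bdd) auto
  have d0: "d \<ge> 0"
    unfolding d_def using \<open>M \<noteq> {}\<close> by (intro cInf_greatest) auto
  \<comment> \<open>The slack is put on the squared distance, the form in which the parallelogram
    law uses it.\<close>
  have "\<exists>m\<in>M. (norm (y - m))\<^sup>2 < d\<^sup>2 + 1 / real (Suc n)" for n
  proof -
    have "d < sqrt (d\<^sup>2 + 1 / real (Suc n))"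
      using d0 by (intro real_less_rsqrt) simp
    then obtain m where "m \<in> M" "norm (y - m) < sqrt (d\<^sup>2 + 1 / real (Suc n))"
      using cInf_lessD[of "(\<lambda>m. norm (y - m)) ` M"] \<open>M \<noteq> {}\<close> unfolding d_def by auto
    moreover from this have "(norm (y - m))\<^sup>2 < (sqrt (d\<^sup>2 + 1 / real (Suc n)))\<^sup>2"
      by (intro power_strict_mono) auto
    ultimately show ?thesis by auto
  qed
  then obtain m where mM: "\<And>n. m n \<in> M"
    and m: "\<And>n. (norm (y - m n))\<^sup>2 < d\<^sup>2 + 1 / real (Suc n)"
    by metis
  have close: "(norm (m n - m k))\<^sup>2 \<le> 2 / real (Suc n) + 2 / real (Suc k)" for n k
  proof -
    let ?h = "(1/2) *\<^sub>R (m n + m k)"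
    have "(norm (m n - m k))\<^sup>2 + (norm ((y - m k) + (y - m n)))\<^sup>2
        = 2 * (norm (y - m n))\<^sup>2 + 2 * (norm (y - m k))\<^sup>2"
      using norm_sq_add[of "y - m k" "y - m n"] norm_sq_diff[of "y - m k" "y - m n"] by simp
    moreover have "(y - m k) + (y - m n) = 2 *\<^sub>R (y - ?h)"
      by (simp add: algebra_simps scaleR_2)
    then have "(norm ((y - m k) + (y - m n)))\<^sup>2 = 4 * (norm (y - ?h))\<^sup>2"
      by (simp add: power_mult_distrib)
    moreover have "d\<^sup>2 \<le> (norm (y - ?h))\<^sup>2"
      using d_le[OF mid[OF mM mM]] d0 by (intro power_mono)
    ultimately show ?thesis using m[of n] m[of k] by simp
  qed
  have "Cauchy m"
  proof (rule CauchyI)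
    fix e :: real assume "e > 0"
    then obtain n0 where n0: "inverse (real (Suc n0)) < e\<^sup>2 / 4"
      using reals_Archimedean[of "e\<^sup>2 / 4"] by auto
    have "norm (m n - m k) < e" if "n \<ge> n0" "k \<ge> n0" for n k
    proof -
      have "1 / real (Suc n) \<le> 1 / real (Suc n0)" "1 / real (Suc k) \<le> 1 / real (Suc n0)"
        using that by (simp_all add: frac_le)
      then have "(norm (m n - m k))\<^sup>2 < e\<^sup>2"
        using close[of n k] n0 by (simp add: inverse_eq_divide)
      then show ?thesis by (rule power_less_imp_less_base) (use \<open>e > 0\<close> in simp)
    qed
    then show "\<exists>n0. \<forall>n\<ge>n0. \<forall>k\<ge>n0. norm (m n - m k) < e" by blast
  qed
  then obtain p where p: "m \<longlonglongrightarrow> p"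
    using Cauchy_convergent_iff convergent_def by blast
  have "p \<in> M"
    using closed_sequentially[OF \<open>closed M\<close>] mM p by blast
  have "(norm (y - p))\<^sup>2 \<le> d\<^sup>2 + 0"
  proof (rule LIMSEQ_le)
    show "(\<lambda>n. (norm (y - m n))\<^sup>2) \<longlonglongrightarrow> (norm (y - p))\<^sup>2"
      by (rule tendsto_power[OF tendsto_norm[OF tendsto_diff[OF tendsto_const p]]])
    show "(\<lambda>n. d\<^sup>2 + 1 / real (Suc n)) \<longlonglongrightarrow> d\<^sup>2 + 0"
      by (rule tendsto_add[OF tendsto_const LIMSEQ_Suc[OF lim_1_over_n]])
    show "\<exists>n0. \<forall>n\<ge>n0. (norm (y - m n))\<^sup>2 \<le> d\<^sup>2 + 1 / real (Suc n)"
      using less_imp_le[OF m] by blast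
  qed
  then have "(norm (y - p))\<^sup>2 \<le> d\<^sup>2" by simp
  then have "norm (y - p) \<le> d"
    using d0 by (rule power2_le_imp_le)
  then show thesis
    by (rule that[OF \<open>p \<in> M\<close> order_trans[OF _ d_le]])
qed

text \<open>The nearest point works: if \<open>y - p\<close> had a component along some
  \<open>m\<close>, moving \<open>p\<close> slightly in that direction would decrease the
  distance.\<close>

lemma orthogonal_projection_exists:
  fixes M :: "'a::chilbert_space set"
  assumes "closed M" "0 \<in> M" and add: "\<And>x y. x \<in> M \<Longrightarrow> y \<in> M \<Longrightarrow> x + y \<in> M"
    and scale: "\<And>c x. x \<in> M \<Longrightarrow> c *\<^sub>C x \<in> M"
  obtains p where "p \<in> M" "\<And>m. m \<in> M \<Longrightarrow> cinner (y - p) m = 0"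
proof -
  obtain p where p: "p \<in> M" "\<And>m. m \<in> M \<Longrightarrow> norm (y - p) \<le> norm (y - m)"
  proof (rule nearest_point_exists[OF \<open>closed M\<close>, of y])
    show "M \<noteq> {}" using \<open>0 \<in> M\<close> by blast
    show "(1/2) *\<^sub>R (x + y) \<in> M" if "x \<in> M" "y \<in> M" for x y
      unfolding scaleR_scaleC by (intro scale add that)
  qed blast
  have "cinner (y - p) m = 0" if m: "m \<in> M" for m
  proof -
    define b where "b = (cmod (cinner (y - p) m))\<^sup>2"
    \<comment> \<open>Any positive step with \<open>s * (norm m)\<^sup>2 < 1\<close> keeps the
      quadratic term below the linear gain; adding 1 covers \<open>m = 0\<close>.\<close>
    define s where "s = 1 / ((norm m)\<^sup>2 + 1)"
    define c where "c = of_real s * cinner (y - p) m"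
    have pos: "(norm m)\<^sup>2 + 1 > 0" by (simp add: add_nonneg_pos)
    then have "s > 0" by (simp add: s_def)
    have "s * (norm m)\<^sup>2 < 1" using pos by (simp add: s_def divide_less_eq)
    have "Re (cnj c * cinner (y - p) m) = s * b"
      unfolding b_def c_def cmod_power2 by (simp add: power2_eq_square algebra_simps)
    have "p + c *\<^sub>C m \<in> M" by (intro add scale p m)
    then have "norm (y - p) \<le> norm ((y - p) - c *\<^sub>C m)"
      using p(2) by (simp add: diff_diff_eq)
    then have "(norm (y - p))\<^sup>2 \<le> (norm ((y - p) - c *\<^sub>C m))\<^sup>2"
      by (intro power_mono) auto
    also have "\<dots> = (norm (y - p))\<^sup>2 + s * b * (s * (norm m)\<^sup>2) - 2 * s * b"
      unfolding norm_sq_diff[of "y - p"] norm_scaleC cinner_scaleC_right \<open>Re (cnj c * _) = _\<close>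
      by (simp add: c_def b_def norm_mult power_mult_distrib power2_eq_square)
    finally have "s * b * (2 - s * (norm m)\<^sup>2) \<le> 0" by (simp add: algebra_simps)
    then have "s * b \<le> 0"
      using \<open>s * (norm m)\<^sup>2 < 1\<close> by (simp only: mult_le_0_iff) linarith
    moreover have "s * b \<ge> 0" using \<open>s > 0\<close> by (simp add: b_def)
    ultimately have "s * b = 0" by linarith
    then show ?thesis using \<open>s > 0\<close> by (simp add: b_def)
  qed
  with p show thesis using that by blast
qed

lemma riesz_representation:
  fixes f :: "'a::chilbert_space \<Rightarrow> complex"
  assumes f: "bounded_clinear f"
  obtains z where "\<And>x. f x = cinner x z"
proof (cases "\<forall>x. f x = 0")
  case True
  then show thesis using that[of 0] by simp
next
  case False
  then obtain u where u: "f u \<noteq> 0" by blast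
  have sc: "f (c *\<^sub>C x) = c * f x" for c x
    by (simp add: bounded_clinear_scaleC[OF f] scaleC_complex_def)
  have "closed {x. f x = 0}"
    by (intro closed_Collect_eq continuous_on_const linear_continuous_on bounded_clinear_linear f)
  then obtain p where p: "f p = 0" and orth: "\<And>m. f m = 0 \<Longrightarrow> cinner (u - p) m = 0"
    by (rule orthogonal_projection_exists[where y = u])
      (auto simp: bounded_clinear_zero[OF f] bounded_clinear_add[OF f] sc)
  define z where "z = u - p"
  have fz: "f z \<noteq> 0" using u p by (simp add: z_def bounded_clinear_diff[OF f])
  then have "z \<noteq> 0" using bounded_clinear_zero[OF f] by auto
  show thesis
  proof (rule that)
    fix x
    \<comment> \<open>The vector \<open>f z *\<^sub>C x - f x *\<^sub>C z\<close> lies in the kernel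
      of \<open>f\<close>, to which \<open>z\<close> is orthogonal.\<close>
    have "cinner z (f z *\<^sub>C x - f x *\<^sub>C z) = 0"
      by (rule orth[folded z_def]) (simp add: bounded_clinear_diff[OF f] sc)
    then have "cinner (f z *\<^sub>C x - f x *\<^sub>C z) z = 0"
      using cinner_commute by (metis complex_cnj_zero)
    then have "f z * cinner x z = f x * of_real ((norm z)\<^sup>2)"
      by (simp add: cinner_diff_left cinner_scaleC_left cinner_self)
    then show "f x = cinner x (cnj (f z / of_real ((norm z)\<^sup>2)) *\<^sub>C z)"
      using \<open>z \<noteq> 0\<close> by (simp add: cinner_scaleC_right field_simps)
  qed
qed

text \<open>For each \<open>y\<close> the value \<open>S y\<close> is the Riesz vector of the
  functional sending \<open>x\<close> to \<open>cinner (T x) y\<close>. Linearity and uniqueness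
  follow because vectors are determined by their inner products.\<close>

lemma cadjoint_exists:
  fixes T :: "'a::chilbert_space \<Rightarrow> 'a"
  assumes T: "bounded_clinear T"
  shows "\<exists>!S. bounded_clinear S \<and> (\<forall>x y. cinner (T x) y = cinner x (S y))"
proof -
  obtain K where K: "K > 0" "\<And>x. norm (T x) \<le> K * norm x"
    using bounded_clinear_bound[OF T] by blast
  have "\<exists>z. \<forall>x. cinner (T x) y = cinner x z" for y
  proof -
    have "bounded_clinear (\<lambda>x. cinner (T x) y)"
    proof (rule bounded_clinearI)
      show "cmod (cinner (T x) y) \<le> norm x * (K * norm y)" for x
        using norm_cinner_le[of "T x" y] mult_right_mono[OF K(2), of "norm y" x]
        by (simp add: mult_ac)
    qed (simp_all add: bounded_clinear_add[OF T] bounded_clinear_scaleC[OF T] cinner_add_left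
        cinner_scaleC_left scaleC_complex_def)
    then show ?thesis using riesz_representation by metis
  qed
  then obtain S where S: "\<And>x y. cinner (T x) y = cinner x (S y)" by metis
  have "bounded_clinear S"
  proof (rule bounded_clinearI)
    show "S (x + y) = S x + S y" for x y
      by (rule cinner_ext_right) (simp add: S[symmetric] cinner_add_right)
    show "S (c *\<^sub>C x) = c *\<^sub>C S x" for c x
      by (rule cinner_ext_right) (simp add: S[symmetric] cinner_scaleC_right)
    fix y
    \<comment> \<open>The adjoint relation is tested at \<open>x = S y\<close>, after which one
      factor \<open>norm (S y)\<close> cancels.\<close>
    have "(norm (S y))\<^sup>2 = cmod (cinner (T (S y)) y)"
      by (simp add: S cinner_self norm_power)
    also have "\<dots> \<le> norm (S y) * (norm y * K)"
      using norm_cinner_le[of "T (S y)" y] mult_right_mono[OF K(2), of "norm y" "S y"]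
      by (simp add: mult_ac)
    finally show "norm (S y) \<le> norm y * K"
      using K(1) by (cases "S y = 0") (simp_all add: power2_eq_square)
  qed
  moreover have "S' = S" if "\<forall>x y. cinner (T x) y = cinner x (S' y)" for S'
    by (rule ext, rule cinner_ext_right) (metis that S)
  ultimately show ?thesis using S by blast
qed

lemma cadjoint:
  assumes "bounded_clinear T"
  shows "cinner (T x) y = cinner x (cadjoint T y)"
  using theI'[OF cadjoint_exists[OF assms]] unfolding cadjoint_def by blast

text \<open>The sublevel sets \<open>V n\<close> are closed because they are cut out by weak inequalities, and they
  cover the space; by Baire's theorem one of them contains a ball.\<close>

lemma weakly_bounded_imp_bounded:
  fixes X :: "'a::chilbert_space \<Rightarrow> 'a" and W :: "'b \<Rightarrow> 'a"
  assumes add: "\<And>x y. X (x + y) = X x + X y" and scale: "\<And>c x. X (c *\<^sub>C x) = c *\<^sub>C X x"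
    and weak: "\<And>x n. norm (X x) \<le> real n \<longleftrightarrow> (\<forall>i. cmod (cinner x (W i)) \<le> real n * r i)"
  shows "bounded_clinear X"
proof -
  define V where "V n = {x. norm (X x) \<le> real n}" for n
  have closed: "closed (V n)" for n
  proof -
    have "V n = (\<Inter>i. {x. cmod (cinner x (W i)) \<le> real n * r i})"
      by (auto simp: V_def weak)
    also have "closed \<dots>"
      by (intro closed_INT ballI closed_Collect_le continuous_on_norm continuous_on_cinner_left
          continuous_on_const)
    finally show ?thesis .
  qed
  have cover: "\<Union>(range V) = UNIV"
    using real_arch_simple by (auto simp: V_def)
  have "\<exists>n. interior (V n) \<noteq> {}"
  proof (rule ccontr)
    assume *: "\<nexists>n. interior (V n) \<noteq> {}"
    have "Met_TC.mtopology interior_of \<Union>(range V) = {}"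
    proof (rule Met_TC.metric_Baire_category_alt)
      show "Met_TC.mcomplete TYPE('a)"
        by (auto simp: Met_TC.mcomplete_def Cauchy_convergent_iff convergent_def)
    qed (use * closed in auto)
    then show False by (simp add: cover)
  qed
  then obtain n u where "u \<in> interior (V n)" by blast
  then obtain e where e: "e > 0" "cball u e \<subseteq> V n"
    by (meson interior_subset mem_interior_cball)
  have X0: "X 0 = 0" using scale[of 0 0] by simp
  show ?thesis
  proof (rule bounded_clinearI[OF add scale])
    fix x
    show "norm (X x) \<le> norm x * (2 * real n / e)"
    proof (cases "x = 0")
      case True
      then show ?thesis by (simp add: X0)
    next
      case False
      \<comment> \<open>This rescales \<open>x\<close> to length \<open>e\<close>, so that
        \<open>u\<close> and \<open>u + c *\<^sub>R x\<close> both lie in the ball; the difference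
        of their images is \<open>c *\<^sub>R X x\<close>.\<close>
      define c where "c = e / norm x"
      have "c > 0" using False e by (simp add: c_def)
      have "norm (X u) \<le> n" using subsetD[OF e(2), of u] e(1) by (simp add: V_def)
      moreover have "u + c *\<^sub>R x \<in> cball u e" using False e by (simp add: dist_norm c_def)
      then have "norm (X (u + c *\<^sub>R x)) \<le> n" using e by (auto simp: V_def)
      moreover have "X (u + c *\<^sub>R x) = X u + c *\<^sub>R X x" by (simp add: add scale scaleR_scaleC)
      ultimately have "norm (c *\<^sub>R X x) \<le> 2 * n"
        using norm_triangle_ineq4[of "X u + c *\<^sub>R X x" "X u"] by simp
      then have "c * norm (X x) \<le> 2 * n" using \<open>c > 0\<close> by simp
      then show ?thesis using False e by (simp add: c_def field_simps)
    qed
  qed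
qed

lemma bounded_clinear_cadjoint: "bounded_clinear T \<Longrightarrow> bounded_clinear (cadjoint T)"
  using theI'[OF cadjoint_exists] unfolding cadjoint_def by blast

lemma cadjoint_left:
  assumes "bounded_clinear T"
  shows "cinner (cadjoint T x) y = cinner x (T y)"
  using cadjoint[OF assms, of y x] by (metis cinner_commute)

lemma scaleC_diff_right: "c *\<^sub>C (x - y) = c *\<^sub>C x - c *\<^sub>C (y::'a::complex_inner)"
  using scaleC_add_right[of c "x - y" y] by (simp add: algebra_simps)

lemma scaleC_diff_left: "(c - d) *\<^sub>C x = c *\<^sub>C x - d *\<^sub>C (x::'a::complex_inner)"
  using scaleC_add_left[of "c - d" d x] by (simp add: algebra_simps)

lemma bounded_clinear_scale: "bounded_clinear (\<lambda>x. c *\<^sub>C (x::'a::chilbert_space))"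
  by (rule bounded_clinearI[where K = "cmod c"])
    (simp_all add: scaleC_add_right scaleC_scaleC norm_scaleC mult.commute)

subsection \<open>The adjoint with respect to a positive operator\<close>

context positive_operator
begin

lemma range_mem_add: "x \<in> closure (range A) \<Longrightarrow> y \<in> closure (range A) \<Longrightarrow> x + y \<in> closure (range A)"
proof -
  assume "x \<in> closure (range A)" "y \<in> closure (range A)"
  then obtain u v where u: "\<And>n::nat. u n \<in> range A" "u \<longlonglongrightarrow> x" and v: "\<And>n::nat. v n \<in> range A" "v \<longlonglongrightarrow> y"
    unfolding closure_sequential by blast
  have "u n + v n \<in> range A" for n
    using u(1)[of n] v(1)[of n] by (auto simp: bounded_clinear_add[OF bcl, symmetric])
  moreover have "(\<lambda>n. u n + v n) \<longlonglongrightarrow> x + y"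
    by (rule tendsto_add[OF u(2) v(2)])
  ultimately show ?thesis
    unfolding closure_sequential by (intro exI[of _ "\<lambda>n. u n + v n"] conjI allI)
qed

lemma range_mem_scaleC: "x \<in> closure (range A) \<Longrightarrow> c *\<^sub>C x \<in> closure (range A)"
proof -
  assume "x \<in> closure (range A)"
  then obtain u where u: "\<And>n::nat. u n \<in> range A" "u \<longlonglongrightarrow> x"
    unfolding closure_sequential by blast
  have "c *\<^sub>C u n \<in> range A" for n
    using u(1)[of n] by (auto simp: bounded_clinear_scaleC[OF bcl, symmetric])
  moreover have "(\<lambda>n. c *\<^sub>C u n) \<longlonglongrightarrow> c *\<^sub>C x"
    by (rule bounded_linear.tendsto[OF bounded_clinear_linear[OF bounded_clinear_scale] u(2)])
  ultimately show ?thesis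
    unfolding closure_sequential by (intro exI[of _ "\<lambda>n. c *\<^sub>C u n"] conjI allI)
qed

text \<open>Since \<open>A\<close> is selfadjoint, its kernel is orthogonal to its range and, by
  continuity, to the closure; so \<open>u\<close> is orthogonal to itself.\<close>

lemma kernel_inter_closure_range:
  assumes "A u = 0" "u \<in> closure (range A)"
  shows "u = 0"
proof -
  have "closed {y. cinner y u = 0}"
    by (intro closed_Collect_eq continuous_on_const continuous_on_cinner_left)
  moreover have "range A \<subseteq> {y. cinner y u = 0}"
    using assms(1) by (auto simp: selfadjoint)
  ultimately have "closure (range A) \<subseteq> {y. cinner y u = 0}"
    by (rule closure_minimal[rotated])
  with assms(2) show ?thesis by (auto simp: cinner_self)
qed

lemma inj_on_closure_range:
  assumes "A u = A v" "u \<in> closure (range A)" "v \<in> closure (range A)"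
  shows "u = v"
proof -
  have "u - v \<in> closure (range A)"
    using range_mem_add[OF assms(2) range_mem_scaleC[OF assms(3), of "-1"]]
    by (simp add: scaleC_minus_one)
  then show ?thesis
    using kernel_inter_closure_range[of "u - v"] assms(1) by (simp add: bounded_clinear_diff[OF bcl])
qed

text \<open>Take \<open>p\<close> to be the orthogonal projection of \<open>y\<close>: what is left
  over is orthogonal to the range of the selfadjoint \<open>A\<close> and is therefore killed by
  \<open>A\<close>.\<close>

lemma preimage_in_closure_range:
  obtains p where "p \<in> closure (range A)" "A p = A y"
proof -
  have "0 \<in> range A"
    using bounded_clinear_zero[OF bcl] by (metis rangeI)
  then have "0 \<in> closure (range A)"
    by (rule subsetD[OF closure_subset])
  then obtain p where p: "p \<in> closure (range A)" "\<And>m. m \<in> closure (range A) \<Longrightarrow> cinner (y - p) m = 0"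
    by (rule orthogonal_projection_exists[OF closed_closure, where y = y])
      (auto intro: range_mem_add range_mem_scaleC)
  have "cinner (A (y - p)) (A (y - p)) = cinner (y - p) (A (A (y - p)))"
    by (rule selfadjoint)
  also have "\<dots> = 0"
    by (intro p(2) subsetD[OF closure_subset] rangeI)
  finally have "A p = A y"
    by (simp add: cinner_self bounded_clinear_diff[OF bcl])
  with p(1) show thesis by (rule that)
qed

text \<open>The range inclusion makes \<open>A u = cadjoint T (A x)\<close> solvable, and the
  solution in the closure of the range is unique; call it \<open>X x\<close>. Uniqueness gives
  linearity of \<open>X\<close>. For boundedness, the size of \<open>X x\<close> is expressed
  through the pairings of \<open>x\<close> with the vectors \<open>A (T w)\<close>.\<close>

lemma A_adjoint_exists:
  assumes "T \<in> A_adjointable_ops A"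
  shows "\<exists>!X. bounded_clinear X \<and> A \<circ> X = cadjoint T \<circ> A \<and> range X \<subseteq> closure (range A)"
proof -
  have T: "bounded_clinear T" and sub: "range (cadjoint T \<circ> A) \<subseteq> range A"
    using assms by (auto simp: A_adjointable_ops_def)
  note T' = bounded_clinear_cadjoint[OF T]
  have "\<exists>u\<in>closure (range A). A u = cadjoint T (A x)" for x
  proof -
    obtain y where "cadjoint T (A x) = A y" using sub by fastforce
    then show ?thesis using preimage_in_closure_range[of y] by metis
  qed
  then obtain X where XM: "\<And>x. X x \<in> closure (range A)" and AX: "\<And>x. A (X x) = cadjoint T (A x)"
    by metis
  have weak: "cinner (X x) (A w) = cinner x (A (T w))" for x w
    by (simp add: selfadjoint[symmetric] AX cadjoint_left[OF T])
  have "bounded_clinear X"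
  proof (rule weakly_bounded_imp_bounded[where W = "\<lambda>w. A (T w)" and r = "\<lambda>w. norm (A w)"])
    show "X (x + y) = X x + X y" for x y
      by (rule inj_on_closure_range)
        (simp_all add: AX XM range_mem_add bounded_clinear_add[OF bcl] bounded_clinear_add[OF T'])
    show "X (c *\<^sub>C x) = c *\<^sub>C X x" for c x
      by (rule inj_on_closure_range)
        (simp_all add: AX XM range_mem_scaleC bounded_clinear_scaleC[OF bcl] bounded_clinear_scaleC[OF T'])
    fix x and n :: nat
    show "norm (X x) \<le> real n \<longleftrightarrow> (\<forall>w. cmod (cinner x (A (T w))) \<le> real n * norm (A w))"
      (is "?l \<longleftrightarrow> ?r")
    proof
      assume ?l
      show ?r
      proof
        fix w
        have "cmod (cinner x (A (T w))) \<le> norm (X x) * norm (A w)"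
          unfolding weak[symmetric] by (rule norm_cinner_le)
        also have "\<dots> \<le> real n * norm (A w)"
          using \<open>?l\<close> by (rule mult_right_mono) simp
        finally show "cmod (cinner x (A (T w))) \<le> real n * norm (A w)" .
      qed
    next
      assume r: ?r
      \<comment> \<open>The assumed bound controls the pairing of \<open>X x\<close> with the range
        of \<open>A\<close>. It passes to the closure, which contains \<open>X x\<close>, and there
        \<open>X x\<close> is paired with itself.\<close>
      let ?C = "{y. cmod (cinner y (X x)) \<le> real n * norm y}"
      have "closed ?C"
        by (intro closed_Collect_le continuous_on_norm continuous_on_cinner_left
            continuous_on_mult_left continuous_on_id)
      moreover have "cmod (cinner (A w) (X x)) \<le> real n * norm (A w)" for w
        using r[rule_format, of w] unfolding weak[symmetric] cinner_commute[of "A w" "X x"] by simp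
      then have "range A \<subseteq> ?C" by blast
      ultimately have "closure (range A) \<subseteq> ?C" by (rule closure_minimal[rotated])
      then have "cmod (cinner (X x) (X x)) \<le> real n * norm (X x)" using XM by blast
      then have "norm (X x) * norm (X x) \<le> real n * norm (X x)"
        by (simp add: cinner_self norm_power power2_eq_square norm_mult)
      then show ?l
        by (cases "X x = 0") simp_all
    qed
  qed
  moreover have "Y = X" if "A \<circ> Y = cadjoint T \<circ> A" "range Y \<subseteq> closure (range A)" for Y
  proof
    fix x
    have "A (Y x) = A (X x)" using fun_cong[OF that(1), of x] by (simp add: AX)
    then show "Y x = X x" by (rule inj_on_closure_range) (use that(2) XM in auto)
  qed
  ultimately show ?thesis using AX XM by (intro ex1I[of _ X]) (auto simp: fun_eq_iff)
qed

lemma A_adjoint: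
  assumes "T \<in> A_adjointable_ops A"
  shows "bounded_clinear (A_adjoint A T)" and "ip (T x) y = ip x (A_adjoint A T y)"
proof -
  have T: "bounded_clinear T" using assms by (simp add: A_adjointable_ops_def)
  have X: "bounded_clinear (A_adjoint A T)" "A \<circ> A_adjoint A T = cadjoint T \<circ> A"
    using theI'[OF A_adjoint_exists[OF assms]] unfolding A_adjoint_def by blast+
  show "bounded_clinear (A_adjoint A T)" by (rule X)
  have "cinner (T x) (A y) = cinner x (A (A_adjoint A T y))"
    using fun_cong[OF X(2), of y] by (simp add: cadjoint[OF T])
  then show "ip (T x) y = ip x (A_adjoint A T y)"
    by (simp add: A_inner_def selfadjoint)
qed

section \<open>Boundedness of \<open>A\<close>-selfadjoint operators\<close>

lemma N_le_norm:
  obtains C where "C > 0" "\<And>x. N x \<le> C * norm x"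
proof -
  obtain K where K: "K > 0" "\<And>x. norm (A x) \<le> K * norm x"
    using bounded_clinear_bound[OF bcl] by blast
  have "N x \<le> sqrt K * norm x" for x
  proof (rule power2_le_imp_le)
    have "(N x)\<^sup>2 \<le> cmod (ip x x)" by (simp add: N_sq complex_Re_le_cmod)
    also have "\<dots> \<le> norm (A x) * norm x" unfolding A_inner_def by (rule norm_cinner_le)
    also have "\<dots> \<le> K * norm x * norm x" by (intro mult_right_mono K) simp
    also have "\<dots> = (sqrt K * norm x)\<^sup>2" using K(1) by (simp add: power_mult_distrib power2_eq_square)
    finally show "(N x)\<^sup>2 \<le> (sqrt K * norm x)\<^sup>2" .
  qed (use K(1) in simp)
  then show thesis using K(1) by (intro that[of "sqrt K"]) simp_all
qed

lemma selfadjoint_power: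
  assumes "\<And>x y. ip (W x) y = ip x (W y)"
  shows "ip ((W ^^ n) x) y = ip x ((W ^^ n) y)"
  by (induction n arbitrary: x y) (simp_all add: assms funpow_swap1)

text \<open>Cauchy--Schwarz gives \<open>N (W\<^sup>m x)\<^sup>2 \<le> N (W\<^sup>2\<^sup>m x)\<close> when \<open>N x \<le> 1\<close>. Iterating along powers of
  two, \<open>N (W x)\<close> to the power \<open>2\<^sup>n\<close> is \<open>O(\<parallel>W\<parallel>^(2\<^sup>n))\<close>, and the constant disappears in the limit.\<close>

lemma selfadjoint_bound:
  assumes W: "bounded_clinear W" and sa: "\<And>x y. ip (W x) y = ip x (W y)"
  obtains K where "K > 0" "\<And>x. N (W x) \<le> K * N x"
proof -
  obtain K where K: "K > 0" "\<And>x. norm (W x) \<le> K * norm x"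
    using bounded_clinear_bound[OF W] by blast
  obtain C where C: "C > 0" "\<And>x. N x \<le> C * norm x"
    using N_le_norm by blast
  have pow: "norm ((W ^^ n) x) \<le> K ^ n * norm x" for n x
  proof (induction n)
    case (Suc n)
    have "norm ((W ^^ Suc n) x) \<le> K * norm ((W ^^ n) x)" using K(2) by simp
    also have "\<dots> \<le> K * (K ^ n * norm x)" using Suc K(1) by (intro mult_left_mono) auto
    finally show ?case by (simp add: mult.assoc)
  qed simp
  have unit: "N (W x) \<le> K" if "N x \<le> 1" for x
  proof (rule ccontr)
    define q where "q = N (W x) / K"
    assume "\<not> N (W x) \<le> K"
    then have "q > 1" using K(1) by (simp add: q_def)
    have step: "(N ((W ^^ m) x))\<^sup>2 \<le> N ((W ^^ (m + m)) x)" for m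
    proof -
      have "(N ((W ^^ m) x))\<^sup>2 = Re (ip x ((W ^^ (m + m)) x))"
        unfolding N_sq funpow_add by (simp add: selfadjoint_power[OF sa])
      also have "\<dots> \<le> N x * N ((W ^^ (m + m)) x)"
        using complex_Re_le_cmod cauchy_schwarz by (rule order_trans)
      also have "\<dots> \<le> 1 * N ((W ^^ (m + m)) x)"
        using that by (rule mult_right_mono) simp
      finally show ?thesis by simp
    qed
    have iter: "N (W x) ^ (2 ^ n) \<le> N ((W ^^ (2 ^ n)) x)" for n
    proof (induction n)
      case (Suc n)
      have "N (W x) ^ (2 ^ Suc n) = (N (W x) ^ (2 ^ n))\<^sup>2"
        by (simp add: power_mult[symmetric] mult.commute)
      also have "\<dots> \<le> (N ((W ^^ (2 ^ n)) x))\<^sup>2" using Suc by (rule power_mono) simp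
      also have "\<dots> \<le> N ((W ^^ (2 ^ n + 2 ^ n)) x)" by (rule step)
      finally show ?case by (simp add: mult_2)
    qed simp
    have "q ^ (2 ^ n) \<le> C * norm x" for n
    proof -
      have "N (W x) ^ (2 ^ n) \<le> C * norm ((W ^^ (2 ^ n)) x)"
        using iter C(2) by (rule order_trans)
      also have "\<dots> \<le> C * (K ^ (2 ^ n) * norm x)" using C(1) pow by (intro mult_left_mono) auto
      finally show ?thesis using K(1) by (simp add: q_def power_divide divide_le_eq mult_ac)
    qed
    moreover obtain n where "C * norm x < q ^ n" using real_arch_pow[OF \<open>q > 1\<close>] by blast
    \<comment> \<open>The iteration only reaches exponents that are powers of two;
      \<open>n \<le> 2 ^ n\<close> turns an arbitrary large exponent into one of these.\<close>
    moreover have "q ^ n \<le> q ^ (2 ^ n)"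
      using \<open>q > 1\<close> by (intro power_increasing) (auto intro: less_imp_le)
    ultimately show False by (meson not_le order_trans)
  qed
  have "N (W x) \<le> K * N x" for x
  proof (rule field_le_epsilon)
    fix e :: real assume "e > 0"
    \<comment> \<open>As \<open>N x\<close> may vanish, the scaling is by a slightly larger positive
      number, chosen so that \<open>K * d = K * N x + e\<close>.\<close>
    define d where "d = N x + e / K"
    have "d > 0" using \<open>e > 0\<close> K(1) by (simp add: d_def add_nonneg_pos)
    have "N (of_real (1 / d) *\<^sub>C x) \<le> 1"
      using \<open>d > 0\<close> \<open>e > 0\<close> K(1) unfolding N_scaleC norm_of_real by (simp add: d_def)
    then have "N (W (of_real (1 / d) *\<^sub>C x)) \<le> K" by (rule unit)
    then have "N (W x) \<le> K * d"
      using \<open>d > 0\<close> unfolding bounded_clinear_scaleC[OF W] N_scaleC norm_of_real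
      by (simp add: divide_le_eq)
    then show "N (W x) \<le> K * N x + e" using K(1) by (simp add: d_def algebra_simps)
  qed
  with K(1) show thesis by (rule that)
qed

end

subsection \<open>Parallelism and approximate eigenvectors\<close>

locale nonzero_positive_operator = positive_operator +
  assumes nonzero: "A \<noteq> (\<lambda>x. 0)"
begin

section \<open>The operator seminorm\<close>

abbreviation opn where "opn \<equiv> A_opnorm A"

text \<open>Ensures that the supremum defining \<open>A_opnorm\<close> is over a nonempty set. If
  \<open>N x\<close> were zero, Cauchy--Schwarz against \<open>A x\<close> would force
  \<open>A x = 0\<close>.\<close>

lemma unit_exists: "\<exists>x. N x = 1"
proof -
  obtain x where x: "A x \<noteq> 0" using nonzero by blast
  have "N x \<noteq> 0"
  proof
    assume "N x = 0"
    then have "ip x (A x) = 0" using cauchy_schwarz[of x "A x"] by simp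
    with x show False by (simp add: A_inner_def cinner_self)
  qed
  then have "N (of_real (1 / N x) *\<^sub>C x) = 1"
    unfolding N_scaleC norm_of_real by simp
  then show ?thesis by blast
qed

text \<open>The bound \<open>b\<close> makes the set of values bounded above, without which
  \<open>Sup\<close> on the reals carries no information.\<close>

lemma opn_upper:
  assumes "\<And>x. N x = 1 \<Longrightarrow> N (f x) \<le> b" and "N x = 1"
  shows "N (f x) \<le> opn f"
  unfolding A_opnorm_def
  by (rule cSup_upper) (use assms in \<open>auto intro!: bdd_aboveI[of _ b]\<close>)

lemma opn_le:
  assumes "\<And>x. N x = 1 \<Longrightarrow> N (f x) \<le> b"
  shows "opn f \<le> b"
  unfolding A_opnorm_def
  by (rule cSup_least) (use assms unit_exists in auto)

lemma opn_sequence: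
  assumes b: "\<And>x. N x = 1 \<Longrightarrow> N (f x) \<le> b"
  obtains x where "\<And>n::nat. N (x n) = 1" "(\<lambda>n. N (f (x n))) \<longlonglongrightarrow> opn f"
proof -
  have "\<exists>x. N x = 1 \<and> opn f - 1 / real (Suc n) < N (f x)" for n
    using less_cSupD[of "{N (f x) |x. N x = 1}" "opn f - 1 / real (Suc n)"] unit_exists
    by (auto simp: A_opnorm_def)
  then obtain x where x: "\<And>n. N (x n) = 1" "\<And>n. opn f - 1 / real (Suc n) < N (f (x n))"
    by metis
  have "(\<lambda>n. N (f (x n))) \<longlonglongrightarrow> opn f"
  proof (rule tendsto_sandwich)
    show "(\<lambda>n. opn f - 1 / real (Suc n)) \<longlonglongrightarrow> opn f"
      using tendsto_diff[OF tendsto_const LIMSEQ_Suc[OF lim_1_over_n], of "opn f"] by simp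
    show "\<forall>\<^sub>F n in sequentially. opn f - 1 / real (Suc n) \<le> N (f (x n))"
      using x(2) by (intro always_eventually allI less_imp_le)
    show "\<forall>\<^sub>F n in sequentially. N (f (x n)) \<le> opn f"
      by (intro always_eventually allI opn_upper[where b = b] b x(1))
  qed simp
  with x(1) show thesis by (rule that)
qed

lemma A_bounded_clinear: "T \<in> A_bounded_ops A \<Longrightarrow> bounded_clinear T"
  by (simp add: A_bounded_ops_def)

lemma opn_bound:
  assumes "T \<in> A_bounded_ops A"
  shows "N (T x) \<le> opn T * N x"
proof -
  obtain c where c: "\<And>x. N (T x) \<le> c * N x"
    using assms by (auto simp: A_bounded_ops_def)
  have unit: "N (T y) \<le> c" if "N y = 1" for y
    using c[of y] that by simp
  show ?thesis
  proof (cases "N x = 0")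
    \<comment> \<open>Such an \<open>x\<close> cannot be normalized, but
      \<open>A\<close>-boundedness sends it to a vector of seminorm zero.\<close>
    case True
    then show ?thesis using c[of x] by simp
  next
    case False
    then have "N (of_real (1 / N x) *\<^sub>C x) = 1"
      unfolding N_scaleC norm_of_real by simp
    with unit have "N (T (of_real (1 / N x) *\<^sub>C x)) \<le> opn T"
      by (rule opn_upper)
    moreover have "N x > 0" using False N_nonneg[of x] by linarith
    ultimately show ?thesis
      unfolding bounded_clinear_scaleC[OF A_bounded_clinear[OF assms]] N_scaleC norm_of_real
      by (simp add: divide_le_eq)
  qed
qed

lemma opn_bound_unit: "T \<in> A_bounded_ops A \<Longrightarrow> N x = 1 \<Longrightarrow> N (T x) \<le> opn T"
  using opn_bound[of T x] by simp

lemma opn_nonneg: "T \<in> A_bounded_ops A \<Longrightarrow> opn T \<ge> 0"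
  using unit_exists by (meson opn_bound_unit N_nonneg order_trans)

lemma N_tendsto_zero:
  assumes "\<And>n::nat. N (f n) \<le> g n" and "g \<longlonglongrightarrow> 0"
  shows "(\<lambda>n. N (f n)) \<longlonglongrightarrow> 0"
  by (rule tendsto_sandwich[OF _ _ tendsto_const assms(2)]) (simp_all add: assms(1))

lemma N_add_scale_le:
  assumes "T \<in> A_bounded_ops A" "S \<in> A_bounded_ops A" "cmod c = 1" "N x = 1"
  shows "N (T x + c *\<^sub>C S x) \<le> opn T + opn S"
  using N_triangle[of "T x" "c *\<^sub>C S x"] opn_bound_unit[OF assms(1,4)] opn_bound_unit[OF assms(2,4)]
  by (simp add: N_scaleC assms(3))

text \<open>Vectors almost attaining the norm of \<open>T + c S\<close> almost attain both operator norms, and their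
  images under \<open>T\<close> and \<open>c S\<close> are almost aligned.\<close>

lemma parallel_sequence:
  assumes "A_parallel A T S"
  obtains c x where "cmod c = 1" "\<forall>n::nat. N (x n) = 1"
    "(\<lambda>n. N (T (x n))) \<longlonglongrightarrow> opn T" "(\<lambda>n. N (S (x n))) \<longlonglongrightarrow> opn S"
    "(\<lambda>n. N (of_real (opn S) *\<^sub>C T (x n) - (of_real (opn T) * c) *\<^sub>C S (x n))) \<longlonglongrightarrow> 0"
proof -
  from assms obtain c where T: "T \<in> A_bounded_ops A" and S: "S \<in> A_bounded_ops A" and c: "cmod c = 1"
    and eq: "opn (\<lambda>x. T x + c *\<^sub>C S x) = opn T + opn S"
    by (auto simp: A_parallel_def)
  obtain x where x: "\<And>n::nat. N (x n) = 1"
    and lim: "(\<lambda>n. N (T (x n) + c *\<^sub>C S (x n))) \<longlonglongrightarrow> opn T + opn S"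
    by (rule opn_sequence[where f = "\<lambda>x. T x + c *\<^sub>C S x" and b = "opn T + opn S"])
      (auto simp: N_add_scale_le[OF T S c] eq)
  note Tle = opn_bound_unit[OF T x] and Sle = opn_bound_unit[OF S x]
  have tri: "N (T (x n) + c *\<^sub>C S (x n)) \<le> N (T (x n)) + N (S (x n))" for n
    using N_triangle[of "T (x n)" "c *\<^sub>C S (x n)"] by (simp add: N_scaleC c)
  have limT: "(\<lambda>n. N (T (x n))) \<longlonglongrightarrow> opn T"
  proof (rule tendsto_sandwich)
    \<comment> \<open>The other summand contributes at most its operator seminorm, so what remains
      must come from \<open>T (x n)\<close>.\<close>
    show "(\<lambda>n. N (T (x n) + c *\<^sub>C S (x n)) - opn S) \<longlonglongrightarrow> opn T"
      using tendsto_diff[OF lim tendsto_const, of "opn S"] by simp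
    show "\<forall>\<^sub>F n in sequentially. N (T (x n) + c *\<^sub>C S (x n)) - opn S \<le> N (T (x n))"
    proof (intro always_eventually allI)
      show "N (T (x n) + c *\<^sub>C S (x n)) - opn S \<le> N (T (x n))" for n
        using tri[of n] Sle[of n] by linarith
    qed
  qed (use Tle in auto)
  have limS: "(\<lambda>n. N (S (x n))) \<longlonglongrightarrow> opn S"
  proof (rule tendsto_sandwich)
    show "(\<lambda>n. N (T (x n) + c *\<^sub>C S (x n)) - opn T) \<longlonglongrightarrow> opn S"
      using tendsto_diff[OF lim tendsto_const, of "opn T"] by simp
    show "\<forall>\<^sub>F n in sequentially. N (T (x n) + c *\<^sub>C S (x n)) - opn T \<le> N (S (x n))"
    proof (intro always_eventually allI)
      show "N (T (x n) + c *\<^sub>C S (x n)) - opn T \<le> N (S (x n))" for n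
        using tri[of n] Tle[of n] by linarith
    qed
  qed (use Sle in auto)
  define t s where "t = opn T" and "s = opn S"
  define r where "r n = Re (ip (T (x n)) (c *\<^sub>C S (x n)))" for n
  \<comment> \<open>Solving the expansion of the square of the sum for its mixed term shows that
    \<open>r\<close> tends to \<open>t * s\<close>.\<close>
  have "(\<lambda>n. ((N (T (x n) + c *\<^sub>C S (x n)))\<^sup>2 - (N (T (x n)))\<^sup>2 - (N (S (x n)))\<^sup>2) / 2)
      \<longlonglongrightarrow> ((t + s)\<^sup>2 - t\<^sup>2 - s\<^sup>2) / 2"
    using lim limT limS unfolding t_def s_def by (intro tendsto_intros) simp_all
  then have limr: "r \<longlonglongrightarrow> t * s"
    unfolding N_sq_add N_scaleC c r_def by (simp add: power2_sum)
  \<comment> \<open>In the limit the two squares contribute \<open>s\<^sup>2 * t\<^sup>2\<close>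
    each and the mixed term removes exactly twice that.\<close>
  have sq: "(N (of_real s *\<^sub>C T (x n) - (of_real t * c) *\<^sub>C S (x n)))\<^sup>2
      = s\<^sup>2 * (N (T (x n)))\<^sup>2 + t\<^sup>2 * (N (S (x n)))\<^sup>2 - 2 * (s * t * r n)" for n
    unfolding N_sq_diff N_scaleC norm_mult norm_of_real c r_def ip_simps
    by (simp add: power_mult_distrib algebra_simps)
  have "(\<lambda>n. s\<^sup>2 * (N (T (x n)))\<^sup>2 + t\<^sup>2 * (N (S (x n)))\<^sup>2 - 2 * (s * t * r n))
      \<longlonglongrightarrow> s\<^sup>2 * t\<^sup>2 + t\<^sup>2 * s\<^sup>2 - 2 * (s * t * (t * s))"
    using limT limS limr unfolding t_def[symmetric] s_def[symmetric] by (intro tendsto_intros)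
  then have "(\<lambda>n. (N (of_real s *\<^sub>C T (x n) - (of_real t * c) *\<^sub>C S (x n)))\<^sup>2) \<longlonglongrightarrow> 0"
    unfolding sq by (simp add: power2_eq_square mult_ac)
  from tendsto_real_sqrt[OF this]
  have "(\<lambda>n. N (of_real s *\<^sub>C T (x n) - (of_real t * c) *\<^sub>C S (x n))) \<longlonglongrightarrow> 0"
    by simp
  then show thesis using that[OF c _ limT limS] x by (simp add: t_def s_def)
qed

text \<open>On common approximate eigenvectors whose eigenvalues have maximal modulus, a suitable
  rotation of \<open>S\<close> makes the two eigenvalues point the same way. The sum then stretches
  \<open>x n\<close> by almost \<open>opn T + opn S\<close>.\<close>

lemma parallelI:
  assumes T: "T \<in> A_bounded_ops A" and S: "S \<in> A_bounded_ops A"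
    and c: "cmod c = 1" "cmod d = 1" and x: "\<And>n::nat. N (x n) = 1"
    and lT: "(\<lambda>n. N (T (x n) - (of_real (opn T) * c) *\<^sub>C x n)) \<longlonglongrightarrow> 0"
    and lS: "(\<lambda>n. N (S (x n) - (of_real (opn S) * d) *\<^sub>C x n)) \<longlonglongrightarrow> 0"
  shows "A_parallel A T S"
proof -
  \<comment> \<open>The phase satisfies \<open>e * d = c\<close>, so it turns the eigenvalue of
    \<open>S\<close> into the direction of that of \<open>T\<close>.\<close>
  define e where "e = c * cnj d"
  have e: "cmod e = 1" using c by (simp add: e_def norm_mult)
  have "d * cnj d = 1" using complex_norm_square[of d] c by simp
  then have ed: "e * (of_real s * d) = of_real s * c" for s by (simp add: e_def mult_ac)
  define f where "f = (\<lambda>x. T x + e *\<^sub>C S x)"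
  have fle: "N (f x) \<le> opn T + opn S" if "N x = 1" for x
    unfolding f_def by (rule N_add_scale_le[OF T S e that])
  have "opn T + opn S \<le> opn f"
  proof (rule LIMSEQ_le_const)
    show "(\<lambda>n. opn f + N (T (x n) - (of_real (opn T) * c) *\<^sub>C x n)
        + N (S (x n) - (of_real (opn S) * d) *\<^sub>C x n)) \<longlonglongrightarrow> opn f"
      using tendsto_add[OF tendsto_add[OF tendsto_const lT] lS, of "opn f"] by simp
    have "opn T + opn S \<le> opn f + N (T (x n) - (of_real (opn T) * c) *\<^sub>C x n)
        + N (S (x n) - (of_real (opn S) * d) *\<^sub>C x n)" for n
    proof -
      let ?z = "(of_real (opn T + opn S) * c) *\<^sub>C x n"
      have "f (x n) - ?z = (T (x n) - (of_real (opn T) * c) *\<^sub>C x n)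
          + e *\<^sub>C (S (x n) - (of_real (opn S) * d) *\<^sub>C x n)"
        unfolding f_def scaleC_diff_right scaleC_scaleC ed
        by (simp add: distrib_right scaleC_add_left)
      then have "N (f (x n) - ?z) \<le> N (T (x n) - (of_real (opn T) * c) *\<^sub>C x n)
          + N (S (x n) - (of_real (opn S) * d) *\<^sub>C x n)"
        using N_triangle by (metis N_scaleC e mult_1)
      moreover have "N ?z = opn T + opn S"
        using opn_nonneg[OF T] opn_nonneg[OF S]
        unfolding N_scaleC norm_mult norm_of_real x c by simp
      moreover have "N (f (x n)) \<le> opn f"
        using fle x by (rule opn_upper)
      ultimately show ?thesis using N_triangle_sub[of "f (x n)" ?z] by linarith
    qed
    then show "\<exists>n0. \<forall>n\<ge>n0. opn T + opn S \<le> opn f + N (T (x n) - (of_real (opn T) * c) *\<^sub>C x n)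
        + N (S (x n) - (of_real (opn S) * d) *\<^sub>C x n)"
      by blast
  qed
  moreover have "opn f \<le> opn T + opn S" using fle by (rule opn_le)
  ultimately have "opn f = opn T + opn S" by linarith
  then show ?thesis using T S e unfolding A_parallel_def f_def by blast
qed

text \<open>Says that the approximate point spectrum of \<open>T\<close>, taken in the
  \<open>A\<close>-seminorm, meets the circle of radius \<open>opn T\<close>. One phase
  \<open>c\<close> serves the whole sequence.\<close>

definition approx_eigen where
  "approx_eigen T \<longleftrightarrow> (\<exists>c x. cmod c = 1 \<and> (\<forall>n::nat. N (x n) = 1) \<and>
    (\<lambda>n. N (T (x n) - (of_real (opn T) * c) *\<^sub>C x n)) \<longlonglongrightarrow> 0)"

lemma approx_eigenI:
  assumes "cmod c = 1" "\<And>n::nat. N (x n) = 1"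
    and "(\<lambda>n. N (T (x n) - (of_real (opn T) * c) *\<^sub>C x n)) \<longlonglongrightarrow> 0"
  shows "approx_eigen T"
  using assms unfolding approx_eigen_def by blast

lemma approx_eigenI_eps:
  assumes c: "cmod c = 1"
    and ex: "\<And>e. e > 0 \<Longrightarrow> \<exists>x. N x = 1 \<and> N (T x - (of_real (opn T) * c) *\<^sub>C x) < e"
  shows "approx_eigen T"
proof -
  have "\<exists>x. N x = 1 \<and> N (T x - (of_real (opn T) * c) *\<^sub>C x) < 1 / real (Suc n)" for n
    by (rule ex) simp
  then obtain x where x: "\<And>n. N (x n) = 1"
    "\<And>n. N (T (x n) - (of_real (opn T) * c) *\<^sub>C x n) < 1 / real (Suc n)"
    by metis
  have "(\<lambda>n. N (T (x n) - (of_real (opn T) * c) *\<^sub>C x n)) \<longlonglongrightarrow> 0"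
    using less_imp_le[OF x(2)] by (rule N_tendsto_zero) (rule LIMSEQ_Suc[OF lim_1_over_n])
  with c x(1) show ?thesis by (rule approx_eigenI)
qed

text \<open>Any unit vector serves, with phase 1, because its image has seminorm zero. This settles
  the degenerate case, in which one cannot divide by \<open>opn T\<close>.\<close>

lemma approx_eigen_opn_zero:
  assumes "T \<in> A_bounded_ops A" "opn T = 0"
  shows "approx_eigen T"
proof (rule approx_eigenI_eps)
  fix e :: real assume "e > 0"
  obtain x where "N x = 1" using unit_exists by blast
  then show "\<exists>x. N x = 1 \<and> N (T x - (of_real (opn T) * 1) *\<^sub>C x) < e"
    using opn_bound_unit[OF assms(1), of x] \<open>e > 0\<close> assms(2) by (intro exI[of _ x]) simp
qed simp

end

section \<open>Pairs of mutually adjoint operators\<close>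

locale adjoint_pair = nonzero_positive_operator +
  fixes T X :: "'a::chilbert_space \<Rightarrow> 'a"
  assumes T_bcl: "bounded_clinear T" and X_bcl: "bounded_clinear X"
    and adjoint: "ip (T x) y = ip x (X y)"
begin

lemma adjoint': "ip (X x) y = ip x (T y)"
  by (metis adjoint ip_commute)

text \<open>The adjoint relation is symmetric in \<open>T\<close> and \<open>X\<close>, so every
  fact about one operator of the pair transfers to the other.\<close>

lemma swap: "adjoint_pair A X T"
  by unfold_locales (rule X_bcl T_bcl adjoint')+

text \<open>\<open>X \<circ> T\<close> is \<open>A\<close>-selfadjoint, hence bounded in the
  seminorm, and \<open>(N (T x))\<^sup>2\<close> is the pairing of \<open>x\<close> with
  \<open>X (T x)\<close>.\<close>

lemma bounded_T: "T \<in> A_bounded_ops A"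
proof -
  obtain K where K: "K > 0" "\<And>x. N ((X \<circ> T) x) \<le> K * N x"
    using selfadjoint_bound[OF bounded_clinear_comp[OF X_bcl T_bcl]]
    by (auto simp: adjoint adjoint')
  have "N (T x) \<le> sqrt K * N x" for x
  proof (rule power2_le_imp_le)
    have "(N (T x))\<^sup>2 = Re (ip x (X (T x)))" by (simp add: N_sq adjoint)
    also have "\<dots> \<le> N x * N (X (T x))" using complex_Re_le_cmod cauchy_schwarz by (rule order_trans)
    also have "\<dots> \<le> N x * (K * N x)" using K(2)[of x] by (intro mult_left_mono) auto
    also have "\<dots> = (sqrt K * N x)\<^sup>2" using K(1) by (simp add: power_mult_distrib power2_eq_square)
    finally show "(N (T x))\<^sup>2 \<le> (sqrt K * N x)\<^sup>2" .
  qed (use K(1) in simp)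
  then show ?thesis using K(1) T_bcl by (auto simp: A_bounded_ops_def intro!: exI[of _ "sqrt K"])
qed

lemma bounded_X: "X \<in> A_bounded_ops A"
  by (rule adjoint_pair.bounded_T[OF swap])

lemma opn_X_le: "opn X \<le> opn T"
proof (rule opn_le)
  fix x assume x: "N x = 1"
  have "(N (X x))\<^sup>2 = Re (ip x (T (X x)))" by (simp add: N_sq adjoint')
  also have "\<dots> \<le> N x * N (T (X x))" using complex_Re_le_cmod cauchy_schwarz by (rule order_trans)
  also have "\<dots> \<le> opn T * N (X x)" using opn_bound[OF bounded_T] x by simp
  finally show "N (X x) \<le> opn T"
    using opn_nonneg[OF bounded_T] N_nonneg[of "X x"]
    by (cases "N (X x) = 0") (auto simp: power2_eq_square)
qed

lemma opn_X: "opn X = opn T"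
  using opn_X_le adjoint_pair.opn_X_le[OF swap] by linarith

lemma N_XT_le: "N (X (T x)) \<le> (opn T)\<^sup>2 * N x"
proof -
  have "N (X (T x)) \<le> opn T * N (T x)" using opn_bound[OF bounded_X] by (simp add: opn_X)
  also have "\<dots> \<le> opn T * (opn T * N x)"
    by (intro mult_left_mono opn_bound bounded_T opn_nonneg)
  finally show ?thesis by (simp add: power2_eq_square)
qed

lemma bounded_XT: "X \<circ> T \<in> A_bounded_ops A"
proof -
  have "N ((X \<circ> T) x) \<le> ((opn T)\<^sup>2 + 1) * N x" for x
    using N_XT_le[of x] N_nonneg[of x] by (simp add: distrib_right del: N_nonneg)
  moreover have "(opn T)\<^sup>2 + 1 > 0" by (simp add: add_nonneg_pos)
  ultimately show ?thesis
    using bounded_clinear_comp[OF X_bcl T_bcl] unfolding A_bounded_ops_def by blast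
qed

text \<open>This is the C*-identity. The lower bound again comes from writing
  \<open>(N (T x))\<^sup>2\<close> as the pairing of \<open>x\<close> with
  \<open>X (T x)\<close>.\<close>

lemma opn_XT: "opn (X \<circ> T) = (opn T)\<^sup>2"
proof (rule antisym)
  show "opn (X \<circ> T) \<le> (opn T)\<^sup>2"
  proof (rule opn_le)
    show "N ((X \<circ> T) x) \<le> (opn T)\<^sup>2" if "N x = 1" for x
      using N_XT_le[of x] that by simp
  qed
  have "opn T \<le> sqrt (opn (X \<circ> T))"
  proof (rule opn_le)
    fix x assume x: "N x = 1"
    have "(N (T x))\<^sup>2 = Re (ip x (X (T x)))" by (simp add: N_sq adjoint)
    also have "\<dots> \<le> N x * N (X (T x))" using complex_Re_le_cmod cauchy_schwarz by (rule order_trans)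
    also have "\<dots> \<le> opn (X \<circ> T)" using opn_bound_unit[OF bounded_XT x] x by simp
    finally show "N (T x) \<le> sqrt (opn (X \<circ> T))" by (rule real_le_rsqrt)
  qed
  then have "(opn T)\<^sup>2 \<le> (sqrt (opn (X \<circ> T)))\<^sup>2"
    by (rule power_mono) (rule opn_nonneg[OF bounded_T])
  then show "(opn T)\<^sup>2 \<le> opn (X \<circ> T)"
    by (simp add: opn_nonneg[OF bounded_XT])
qed

text \<open>Expanding the square and using \<open>N (X (T x)) \<le> t\<^sup>2\<close> on unit
  vectors bounds it by a multiple of \<open>t\<^sup>2 - (N (T x))\<^sup>2\<close>, which tends to
  zero.\<close>

lemma approx_eigen_XT:
  assumes x: "\<And>n::nat. N (x n) = 1" and lim: "(\<lambda>n. N (T (x n))) \<longlonglongrightarrow> opn T"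
  shows "(\<lambda>n. N (X (T (x n)) - of_real ((opn T)\<^sup>2) *\<^sub>C x n)) \<longlonglongrightarrow> 0"
proof -
  define t where "t = opn T"
  have "(N (X (T (x n)) - of_real (t\<^sup>2) *\<^sub>C x n))\<^sup>2 \<le> 2 * t\<^sup>2 * (t\<^sup>2 - (N (T (x n)))\<^sup>2)" for n
  proof -
    have "(N (X (T (x n)) - of_real (t\<^sup>2) *\<^sub>C x n))\<^sup>2
        = (N (X (T (x n))))\<^sup>2 + (t\<^sup>2)\<^sup>2 - 2 * (t\<^sup>2 * (N (T (x n)))\<^sup>2)"
      unfolding N_sq_diff N_scaleC x ip_simps adjoint' ip_self by (simp del: of_real_power)
    moreover have "(N (X (T (x n))))\<^sup>2 \<le> (t\<^sup>2)\<^sup>2"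
      using N_XT_le[of "x n"] by (intro power_mono) (simp_all add: t_def x)
    ultimately show ?thesis by (simp add: algebra_simps power2_eq_square)
  qed
  then have "N (X (T (x n)) - of_real (t\<^sup>2) *\<^sub>C x n) \<le> sqrt (2 * t\<^sup>2 * (t\<^sup>2 - (N (T (x n)))\<^sup>2))" for n
    by (rule real_le_rsqrt)
  moreover have "(\<lambda>n. sqrt (2 * t\<^sup>2 * (t\<^sup>2 - (N (T (x n)))\<^sup>2))) \<longlonglongrightarrow> sqrt (2 * t\<^sup>2 * (t\<^sup>2 - t\<^sup>2))"
    using lim unfolding t_def[symmetric] by (intro tendsto_intros)
  then have "(\<lambda>n. sqrt (2 * t\<^sup>2 * (t\<^sup>2 - (N (T (x n)))\<^sup>2))) \<longlonglongrightarrow> 0" by simp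
  ultimately show ?thesis
    unfolding t_def[symmetric] by (rule N_tendsto_zero)
qed

text \<open>Maximal modulus is the point: with \<open>z = ip x (T x)\<close> the squared error is
  \<open>(N (X x))\<^sup>2 + t\<^sup>2 - 2 * t * Re (c * z)\<close>. Here
  \<open>N (X x) \<le> t\<close>, while \<open>c * z\<close> is close to \<open>t\<close> because
  \<open>x\<close> is almost an eigenvector of \<open>T\<close>.\<close>

lemma approx_eigenvalue_adjoint:
  assumes c: "cmod c = 1" and x: "\<And>n::nat. N (x n) = 1"
    and lim: "(\<lambda>n. N (T (x n) - (of_real (opn T) * c) *\<^sub>C x n)) \<longlonglongrightarrow> 0"
  shows "(\<lambda>n. N (X (x n) - (of_real (opn X) * cnj c) *\<^sub>C x n)) \<longlonglongrightarrow> 0"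
proof -
  define t where "t = opn T"
  define e where "e n = N (T (x n) - (of_real t * c) *\<^sub>C x n)" for n
  have t0: "t \<ge> 0" unfolding t_def by (rule opn_nonneg[OF bounded_T])
  have cc: "cnj c * c = 1" using complex_norm_square[of c] c by (simp add: mult.commute)
  have "(N (X (x n) - (of_real t * cnj c) *\<^sub>C x n))\<^sup>2 \<le> 2 * t * e n" for n
  proof -
    define z where "z = ip (x n) (T (x n))"
    have "cmod (ip (x n) (T (x n) - (of_real t * c) *\<^sub>C x n)) \<le> e n"
      using cauchy_schwarz[of "x n" "T (x n) - (of_real t * c) *\<^sub>C x n"] by (simp add: x e_def)
    moreover have "c * ip (x n) (T (x n) - (of_real t * c) *\<^sub>C x n) = c * z - of_real t"
      using cc by (simp add: ip_simps ip_self x z_def algebra_simps)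
    ultimately have "cmod (c * z - of_real t) \<le> e n"
      by (metis c mult_1 norm_mult)
    then have "t - Re (c * z) \<le> e n"
      using complex_Re_le_cmod[of "of_real t - c * z"] by (simp add: norm_minus_commute)
    then have "t * (t - Re (c * z)) \<le> t * e n" using t0 by (rule mult_left_mono)
    moreover have "(N (X (x n) - (of_real t * cnj c) *\<^sub>C x n))\<^sup>2
        = (N (X (x n)))\<^sup>2 + t\<^sup>2 - 2 * (t * Re (c * z))"
      unfolding N_sq_diff N_scaleC norm_mult norm_of_real x ip_simps adjoint' z_def
      by (simp add: c mult.assoc right_diff_distrib)
    moreover have "(N (X (x n)))\<^sup>2 \<le> t\<^sup>2"
      using opn_bound_unit[OF bounded_X x] by (intro power_mono) (simp_all add: t_def opn_X)
    ultimately show ?thesis by (simp add: algebra_simps power2_eq_square)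
  qed
  then have "N (X (x n) - (of_real t * cnj c) *\<^sub>C x n) \<le> sqrt (2 * t * e n)" for n
    by (rule real_le_rsqrt)
  moreover have "(\<lambda>n. sqrt (2 * t * e n)) \<longlonglongrightarrow> sqrt (2 * t * 0)"
    using lim unfolding t_def[symmetric] e_def[symmetric] by (intro tendsto_intros)
  then have "(\<lambda>n. sqrt (2 * t * e n)) \<longlonglongrightarrow> 0" by simp
  ultimately show ?thesis
    unfolding opn_X t_def[symmetric] by (rule N_tendsto_zero)
qed

section \<open>Parallelism characterized by approximate eigenvectors\<close>

lemma approx_eigen_adjoint:
  assumes "approx_eigen T"
  shows "approx_eigen X"
proof -
  obtain c x where cx: "cmod c = 1" "\<And>n::nat. N (x n) = 1"
    "(\<lambda>n. N (T (x n) - (of_real (opn T) * c) *\<^sub>C x n)) \<longlonglongrightarrow> 0"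
    using assms unfolding approx_eigen_def by blast
  show ?thesis
    by (rule approx_eigenI[OF _ cx(2) approx_eigenvalue_adjoint[OF cx]]) (simp add: cx(1))
qed

text \<open>Since \<open>opn id = 1\<close>, near-alignment of \<open>T x\<close> with
  \<open>x\<close> is the approximate eigenvector relation itself. Conversely, \<open>id\<close> has
  every unit vector as an eigenvector of maximal eigenvalue.\<close>

lemma parallel_id_iff: "A_parallel A T id \<longleftrightarrow> approx_eigen T"
proof
  have id: "id \<in> A_bounded_ops A"
    by (auto simp: A_bounded_ops_def bounded_clinear_id intro!: exI[of _ 1])
  have "opn id \<le> 1" by (rule opn_le) simp
  moreover obtain u where "N u = 1" using unit_exists by blast
  with opn_bound_unit[OF id] have "1 \<le> opn id" by force
  ultimately have opn_id: "opn id = 1" by linarith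
  {
    assume "A_parallel A T id"
    then obtain c x where "cmod c = 1" "\<forall>n::nat. N (x n) = 1"
      "(\<lambda>n. N (T (x n))) \<longlonglongrightarrow> opn T" "(\<lambda>n. N (id (x n))) \<longlonglongrightarrow> opn id"
      "(\<lambda>n. N (of_real (opn id) *\<^sub>C T (x n) - (of_real (opn T) * c) *\<^sub>C id (x n))) \<longlonglongrightarrow> 0"
      by (rule parallel_sequence)
    then show "approx_eigen T"
      by (intro approx_eigenI) (simp_all add: opn_id)
  next
    assume "approx_eigen T"
    then obtain c x where "cmod c = 1" "\<And>n::nat. N (x n) = 1"
      "(\<lambda>n. N (T (x n) - (of_real (opn T) * c) *\<^sub>C x n)) \<longlonglongrightarrow> 0"
      unfolding approx_eigen_def by blast
    then show "A_parallel A T id"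
      by (intro parallelI[OF bounded_T id, of c 1 x]) (simp_all add: opn_id)
  }
qed

text \<open>The same sequence is approximately an eigenvector of \<open>T\<close>, of
  \<open>X\<close> and of \<open>X \<circ> T\<close>, with eigenvalues \<open>t * c\<close>,
  \<open>t * cnj c\<close> and \<open>t\<^sup>2\<close>. Each has maximal modulus, so
  \<open>parallelI\<close> applies to both pairs.\<close>

lemma approx_eigen_imp_parallel:
  assumes "approx_eigen T"
  shows "A_parallel A T X" and "A_parallel A (X \<circ> T) X"
proof -
  define t where "t = opn T"
  obtain c x where c: "cmod c = 1" and x: "\<And>n::nat. N (x n) = 1"
    and lim: "(\<lambda>n. N (T (x n) - (of_real t * c) *\<^sub>C x n)) \<longlonglongrightarrow> 0"
    using assms unfolding approx_eigen_def t_def by blast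
  note limX = approx_eigenvalue_adjoint[OF c x lim[unfolded t_def]]
  have c': "cmod (cnj c) = 1" using c by simp
  show "A_parallel A T X"
    by (rule parallelI[OF bounded_T bounded_X c c' x lim[unfolded t_def] limX])
  have cc: "c * cnj c = 1" using complex_norm_square[of c] c by simp
  have "N (X (T (x n)) - of_real (t\<^sup>2) *\<^sub>C x n)
      \<le> t * N (T (x n) - (of_real t * c) *\<^sub>C x n) + t * N (X (x n) - (of_real t * cnj c) *\<^sub>C x n)" for n
  proof -
    \<comment> \<open>Intermediate vector: first \<open>T (x n)\<close> is replaced by its
      approximate value, then \<open>X (x n)\<close> by its own.\<close>
    let ?y = "(of_real t * c) *\<^sub>C X (x n)"
    have t0: "t \<ge> 0" unfolding t_def by (rule opn_nonneg[OF bounded_T])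
    have "X (T (x n)) - ?y = X (T (x n) - (of_real t * c) *\<^sub>C x n)"
      by (simp add: bounded_clinear_diff[OF X_bcl] bounded_clinear_scaleC[OF X_bcl])
    then have "N (X (T (x n)) - ?y) \<le> t * N (T (x n) - (of_real t * c) *\<^sub>C x n)"
      using opn_bound[OF bounded_X] by (simp add: opn_X t_def)
    moreover have "?y - of_real (t\<^sup>2) *\<^sub>C x n = (of_real t * c) *\<^sub>C (X (x n) - (of_real t * cnj c) *\<^sub>C x n)"
    proof -
      have "of_real t * c * (of_real t * cnj c) = of_real (t\<^sup>2) * (c * cnj c)"
        by (simp add: power2_eq_square)
      then show ?thesis unfolding scaleC_diff_right scaleC_scaleC cc by simp
    qed
    then have "N (?y - of_real (t\<^sup>2) *\<^sub>C x n) = t * N (X (x n) - (of_real t * cnj c) *\<^sub>C x n)"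
      using t0 c by (simp add: N_scaleC norm_mult)
    ultimately show ?thesis
      using N_triangle_diff[of "X (T (x n))" "of_real (t\<^sup>2) *\<^sub>C x n" ?y] by linarith
  qed
  moreover have "(\<lambda>n. t * N (T (x n) - (of_real t * c) *\<^sub>C x n)
      + t * N (X (x n) - (of_real t * cnj c) *\<^sub>C x n)) \<longlonglongrightarrow> 0"
    using limX lim unfolding opn_X t_def[symmetric]
    by (intro tendsto_add_zero tendsto_mult_right_zero)
  ultimately have limXT: "(\<lambda>n. N (X (T (x n)) - of_real (t\<^sup>2) *\<^sub>C x n)) \<longlonglongrightarrow> 0"
    by (rule N_tendsto_zero)
  show "A_parallel A (X \<circ> T) X"
    by (rule parallelI[OF bounded_XT bounded_X norm_one c' x _ limX])
      (use limXT in \<open>simp add: opn_XT t_def\<close>)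
qed

text \<open>On almost extremal vectors \<open>T x \<approx> c X x\<close> and \<open>T X x \<approx> t\<^sup>2 x\<close>, so \<open>T\<^sup>2 x \<approx> c t\<^sup>2 x\<close>. With
  \<open>\<mu>\<^sup>2 = c\<close>, the factorization \<open>(T - \<mu> t) (T + \<mu> t) x \<approx> 0\<close> shows that either \<open>(T + \<mu> t) x\<close> is an
  approximate eigenvector for \<open>\<mu> t\<close>, or it is small and \<open>x\<close> itself is one for \<open>- \<mu> t\<close>.\<close>

lemma parallel_adjoint_imp_approx_eigen:
  assumes "A_parallel A T X"
  shows "approx_eigen T"
proof (cases "opn T = 0")
  case True
  then show ?thesis by (rule approx_eigen_opn_zero[OF bounded_T])
next
  case False
  define t where "t = opn T"
  have t: "t > 0" using False opn_nonneg[OF bounded_T] by (simp add: t_def)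
  obtain c x where c: "cmod c = 1" and unit: "\<forall>n::nat. N (x n) = 1"
    and "(\<lambda>n. N (T (x n))) \<longlonglongrightarrow> opn T" and limX: "(\<lambda>n. N (X (x n))) \<longlonglongrightarrow> opn X"
    and lim: "(\<lambda>n. N (of_real (opn X) *\<^sub>C T (x n) - (of_real (opn T) * c) *\<^sub>C X (x n))) \<longlonglongrightarrow> 0"
    using assms by (rule parallel_sequence)
  have x: "N (x n) = 1" for n using unit by blast
  note lim = lim[unfolded opn_X, folded t_def]
  have limTX: "(\<lambda>n. N (T (X (x n)) - of_real (t\<^sup>2) *\<^sub>C x n)) \<longlonglongrightarrow> 0"
    using adjoint_pair.approx_eigen_XT[OF swap x limX] by (simp add: opn_X t_def)
  define \<mu> where "\<mu> = csqrt c"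
  have \<mu>2: "\<mu> * \<mu> = c" by (simp add: \<mu>_def power2_eq_square[symmetric])
  then have "cmod \<mu> * cmod \<mu> = 1" using c by (metis norm_mult)
  then have \<mu>: "cmod \<mu> = 1" using norm_ge_zero[of \<mu>] by (simp add: square_eq_1_iff)
  define y where "y n = T (x n) + (of_real t * \<mu>) *\<^sub>C x n" for n
  have le: "N (T (y n) - (of_real t * \<mu>) *\<^sub>C y n)
      \<le> N (of_real t *\<^sub>C T (x n) - (of_real t * c) *\<^sub>C X (x n)) + N (T (X (x n)) - of_real (t\<^sup>2) *\<^sub>C x n)" for n
  proof -
    have "of_real t * \<mu> * (of_real t * \<mu>) = c * of_real (t\<^sup>2)"
      unfolding \<mu>2[symmetric] by (simp add: power2_eq_square)
    then have "T (y n) - (of_real t * \<mu>) *\<^sub>C y n = T (T (x n)) - c *\<^sub>C of_real (t\<^sup>2) *\<^sub>C x n"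
      unfolding y_def bounded_clinear_add[OF T_bcl] bounded_clinear_scaleC[OF T_bcl]
        scaleC_add_right scaleC_scaleC by simp
    also have "N \<dots> \<le> N (T (T (x n)) - c *\<^sub>C T (X (x n))) + N (c *\<^sub>C T (X (x n)) - c *\<^sub>C of_real (t\<^sup>2) *\<^sub>C x n)"
      by (rule N_triangle_diff)
    also have "c *\<^sub>C T (X (x n)) - c *\<^sub>C of_real (t\<^sup>2) *\<^sub>C x n = c *\<^sub>C (T (X (x n)) - of_real (t\<^sup>2) *\<^sub>C x n)"
      by (simp only: scaleC_diff_right)
    also have "N \<dots> = N (T (X (x n)) - of_real (t\<^sup>2) *\<^sub>C x n)" by (simp add: N_scaleC c)
    also have "T (T (x n)) - c *\<^sub>C T (X (x n)) = T (T (x n) - c *\<^sub>C X (x n))"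
      by (simp add: bounded_clinear_diff[OF T_bcl] bounded_clinear_scaleC[OF T_bcl])
    also have "N \<dots> \<le> t * N (T (x n) - c *\<^sub>C X (x n))"
      unfolding t_def by (rule opn_bound[OF bounded_T])
    also have "t * N (T (x n) - c *\<^sub>C X (x n)) = N (of_real t *\<^sub>C (T (x n) - c *\<^sub>C X (x n)))"
      using t by (simp add: N_scaleC)
    also have "of_real t *\<^sub>C (T (x n) - c *\<^sub>C X (x n)) = of_real t *\<^sub>C T (x n) - (of_real t * c) *\<^sub>C X (x n)"
      by (simp only: scaleC_diff_right scaleC_scaleC)
    finally show ?thesis by simp
  qed
  have lim0: "(\<lambda>n. N (T (y n) - (of_real t * \<mu>) *\<^sub>C y n)) \<longlonglongrightarrow> 0"
    by (rule N_tendsto_zero[OF le tendsto_add_zero[OF lim limTX]])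
  show ?thesis
  proof (cases "(\<lambda>n. N (y n)) \<longlonglongrightarrow> 0")
    case True
    show ?thesis
    proof (rule approx_eigenI[where c = "- \<mu>" and x = x])
      have "y n = T (x n) - (of_real (opn T) * - \<mu>) *\<^sub>C x n" for n
        using scaleC_diff_left[of 0 "of_real t * \<mu>" "x n"] by (simp add: y_def t_def)
      then show "(\<lambda>n. N (T (x n) - (of_real (opn T) * - \<mu>) *\<^sub>C x n)) \<longlonglongrightarrow> 0"
        using True by simp
    qed (use \<mu> x in simp_all)
  next
    case False
    \<comment> \<open>Not tending to zero only gives infinitely many \<open>n\<close> with
      \<open>N (y n)\<close> bounded below; these are enough to find one vector for each
      tolerance.\<close>
    then obtain d where d: "d > 0" and big: "\<And>n0. \<exists>n\<ge>n0. d \<le> N (y n)"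
      by (auto simp: LIMSEQ_iff not_less)
    show ?thesis
    proof (rule approx_eigenI_eps[OF \<mu>])
      fix e :: real assume "e > 0"
      \<comment> \<open>Normalizing \<open>y n\<close> divides the error by
        \<open>N (y n) \<ge> d\<close>, so the error before normalization has to be below
        \<open>e * d\<close>.\<close>
      then have "e * d > 0" using d by simp
      then obtain n0 where n0: "\<And>n. n \<ge> n0 \<Longrightarrow> N (T (y n) - (of_real t * \<mu>) *\<^sub>C y n) < e * d"
        using lim0 by (auto simp: LIMSEQ_iff)
      obtain n where n: "n \<ge> n0" "d \<le> N (y n)" using big by blast
      define r where "r = N (y n)"
      have r: "r \<ge> d" "r > 0" using n d by (simp_all add: r_def)
      let ?z = "of_real (1 / r) *\<^sub>C y n"
      have normalize: "N (of_real (1 / r) *\<^sub>C w) = N w / r" for w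
        using r unfolding N_scaleC norm_of_real by simp
      have "N ?z = 1" using r unfolding normalize by (simp add: r_def)
      moreover have "T ?z - (of_real (opn T) * \<mu>) *\<^sub>C ?z
          = of_real (1 / r) *\<^sub>C (T (y n) - (of_real t * \<mu>) *\<^sub>C y n)"
        unfolding bounded_clinear_scaleC[OF T_bcl] scaleC_diff_right scaleC_scaleC t_def
        by (simp only: mult.commute)
      then have "N (T ?z - (of_real (opn T) * \<mu>) *\<^sub>C ?z) = N (T (y n) - (of_real t * \<mu>) *\<^sub>C y n) / r"
        using normalize by (simp only:)
      moreover have "\<dots> < e"
      proof -
        have "N (T (y n) - (of_real t * \<mu>) *\<^sub>C y n) < e * d" by (rule n0[OF n(1)])
        also have "\<dots> \<le> e * r" using r \<open>e > 0\<close> by simp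
        finally show ?thesis using r by (simp add: divide_less_eq)
      qed
      ultimately show "\<exists>x. N x = 1 \<and> N (T x - (of_real (opn T) * \<mu>) *\<^sub>C x) < e" by force
    qed
  qed
qed

text \<open>Alignment gives \<open>t X T x\<close> close to \<open>t\<^sup>2 c X x\<close>, and
  \<open>X T x\<close> is close to \<open>t\<^sup>2 x\<close>. Comparing the two makes
  \<open>X x\<close> close to \<open>t * cnj c\<close> times \<open>x\<close>; the eigenvalue then
  passes from \<open>X\<close> to its adjoint \<open>T\<close>.\<close>

lemma parallel_XT_imp_approx_eigen:
  assumes "A_parallel A (X \<circ> T) X"
  shows "approx_eigen T"
proof (cases "opn T = 0")
  case True
  then show ?thesis by (rule approx_eigen_opn_zero[OF bounded_T])
next
  case False
  define t where "t = opn T"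
  have t: "t > 0" using False opn_nonneg[OF bounded_T] by (simp add: t_def)
  obtain c x where c: "cmod c = 1" and unit: "\<forall>n::nat. N (x n) = 1"
    and limXT: "(\<lambda>n. N ((X \<circ> T) (x n))) \<longlonglongrightarrow> opn (X \<circ> T)"
    and "(\<lambda>n. N (X (x n))) \<longlonglongrightarrow> opn X"
    and lim: "(\<lambda>n. N (of_real (opn X) *\<^sub>C (X \<circ> T) (x n)
      - (of_real (opn (X \<circ> T)) * c) *\<^sub>C X (x n))) \<longlonglongrightarrow> 0"
    using assms by (rule parallel_sequence)
  have x: "N (x n) = 1" for n using unit by blast
  have limT: "(\<lambda>n. N (T (x n))) \<longlonglongrightarrow> opn T"
  \<comment> \<open>As \<open>X\<close> stretches by at most \<open>t\<close>, a vector on which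
    \<open>X \<circ> T\<close> almost attains its norm \<open>t\<^sup>2\<close> must almost attain
    the norm \<open>t\<close> of \<open>T\<close>.\<close>
  proof (rule tendsto_sandwich[OF _ _ _ tendsto_const])
    have "(\<lambda>n. N (X (T (x n))) / t) \<longlonglongrightarrow> t\<^sup>2 / t"
      using limXT t by (intro tendsto_intros) (simp_all add: opn_XT t_def)
    then show "(\<lambda>n. N (X (T (x n))) / t) \<longlonglongrightarrow> opn T"
      using t by (simp add: t_def power2_eq_square)
    have "N (X (T (x n))) / t \<le> N (T (x n))" for n
      using opn_bound[OF bounded_X, of "T (x n)"] t
      by (simp add: opn_X t_def[symmetric] divide_le_eq mult.commute)
    then show "\<forall>\<^sub>F n in sequentially. N (X (T (x n))) / t \<le> N (T (x n))"
      by (intro always_eventually allI)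
    show "\<forall>\<^sub>F n in sequentially. N (T (x n)) \<le> opn T"
      by (intro always_eventually allI opn_bound_unit bounded_T x)
  qed
  have cc: "c * cnj c = 1" using complex_norm_square[of c] c by simp
  let ?u = "\<lambda>n. N (of_real t *\<^sub>C X (T (x n)) - (of_real (t\<^sup>2) * c) *\<^sub>C X (x n))"
  let ?v = "\<lambda>n. N (X (T (x n)) - of_real (t\<^sup>2) *\<^sub>C x n)"
  have le: "N (X (x n) - (of_real t * cnj c) *\<^sub>C x n) \<le> (?u n + t * ?v n) / t\<^sup>2" for n
  proof -
    have "of_real (t\<^sup>2) * c * (of_real t * cnj c) = of_real t * of_real (t\<^sup>2) * (c * cnj c)"
      by (simp add: mult_ac)
    also have "\<dots> = of_real t * of_real (t\<^sup>2)" by (simp only: cc mult_1_right)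
    finally have "(of_real (t\<^sup>2) * c) *\<^sub>C (X (x n) - (of_real t * cnj c) *\<^sub>C x n)
        = (of_real (t\<^sup>2) * c) *\<^sub>C X (x n) - of_real t *\<^sub>C of_real (t\<^sup>2) *\<^sub>C x n"
      by (simp only: scaleC_diff_right scaleC_scaleC)
    then have "t\<^sup>2 * N (X (x n) - (of_real t * cnj c) *\<^sub>C x n)
        = N ((of_real (t\<^sup>2) * c) *\<^sub>C X (x n) - of_real t *\<^sub>C of_real (t\<^sup>2) *\<^sub>C x n)"
      using N_scaleC[of "of_real (t\<^sup>2) * c" "X (x n) - (of_real t * cnj c) *\<^sub>C x n"] c
      by (simp add: norm_mult norm_power)
    also have "\<dots> \<le> ?u n + N (of_real t *\<^sub>C X (T (x n)) - of_real t *\<^sub>C of_real (t\<^sup>2) *\<^sub>C x n)"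
      unfolding N_minus_commute[of "of_real t *\<^sub>C X (T (x n))" "(of_real (t\<^sup>2) * c) *\<^sub>C X (x n)"]
      by (rule N_triangle_diff)
    also have "of_real t *\<^sub>C X (T (x n)) - of_real t *\<^sub>C of_real (t\<^sup>2) *\<^sub>C x n
        = of_real t *\<^sub>C (X (T (x n)) - of_real (t\<^sup>2) *\<^sub>C x n)"
      by (simp only: scaleC_diff_right)
    also have "N \<dots> = t * ?v n" using t unfolding N_scaleC norm_of_real by simp
    finally show ?thesis using t by (simp add: pos_le_divide_eq mult.commute)
  qed
  have "?u \<longlonglongrightarrow> 0" using lim by (simp add: opn_X opn_XT t_def)
  moreover have "?v \<longlonglongrightarrow> 0" using approx_eigen_XT[OF x limT] by (simp add: t_def)
  ultimately have "(\<lambda>n. (?u n + t * ?v n) / t\<^sup>2) \<longlonglongrightarrow> 0"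
    by (intro tendsto_divide_zero tendsto_add_zero tendsto_mult_right_zero)
  with le have "(\<lambda>n. N (X (x n) - (of_real t * cnj c) *\<^sub>C x n)) \<longlonglongrightarrow> 0"
    by (rule N_tendsto_zero)
  then have "approx_eigen X"
    using c x by (intro approx_eigenI[where c = "cnj c"]) (simp_all add: opn_X t_def)
  then show ?thesis by (rule adjoint_pair.approx_eigen_adjoint[OF swap])
qed

end

theorem theorem2p2:
  fixes A T :: "'a::chilbert_space \<Rightarrow> 'a"
  assumes "\<exists>x::'a. x \<noteq> 0"
    and "positive_op A"
    and "A \<noteq> (\<lambda>x. 0)"
    and "T \<in> A_adjointable_ops A"
  shows "(A_parallel A T id \<longleftrightarrow> A_parallel A T (A_adjoint A T))
    \<and> (A_parallel A T (A_adjoint A T) \<longleftrightarrow> A_parallel A (A_adjoint A T \<circ> T) (A_adjoint A T))"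
proof -
  \<comment> \<open>Interpreted first, since the facts on \<open>A_adjoint\<close> that supply the
    adjoint pair are proved in this locale.\<close>
  interpret positive_operator A by unfold_locales (rule assms)
  interpret adjoint_pair A T "A_adjoint A T"
    by unfold_locales
      (use assms A_adjoint[OF assms(4)] in \<open>auto simp: A_adjointable_ops_def\<close>)
  show ?thesis
    using parallel_id_iff approx_eigen_imp_parallel parallel_adjoint_imp_approx_eigen
      parallel_XT_imp_approx_eigen by blast
qed

end
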